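(* Let $p$ be any polynomial. Let $M$ be a two-way probabilistic finite automaton (2pfa) such that, for every input string of length $n$, the expected number of coin tosses performed by $M$ on its halting computational branches is $O(p(n))$. If $M$ recognizes a language $L$ with bounded error, then $L$ is regular.
   Context: A 2pfa is a finite-state machine with a single two-way read-only head on a tape containing the input string between two end-marker symbols, with access to fair coin flips; its states are partitioned into coin-tossing states, deterministic states, an accept state and a reject state. $M$ recognizes $L$ with bounded error if there is $\varepsilon<\frac12$ such that every $x\in L$ is accepted with probability at least $1-\varepsilon$ and every $x\notin L$ is rejected with probability at least $1-\varepsilon$. *)

theory Defs
  imports "HOL-Analysis.Infinite_Sum" "HOL-Computational_Algebra.Polynomial"
begin

section \<open>Two-way probabilistic finite automata\<close>

datatype 'a tape_symbol = Left_End | Letter 'a | Right_End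

datatype move = Move_Left | Stay | Move_Right

text \<open>
  The Boolean argument of \<open>coin_step\<close> is the outcome of the coin toss. The automaton is specified by
  its transition functions on all arguments, but only the values on coin-tossing (deterministic)
  states and symbols over the alphabet matter.
\<close>

record ('q, 'a) pfa2 =
  alphabet :: "'a set"
  coin_states :: "'q set"
  det_states :: "'q set"
  accept :: 'q
  reject :: 'q
  start :: 'q
  coin_step :: "'q \<Rightarrow> 'a tape_symbol \<Rightarrow> bool \<Rightarrow> 'q \<times> move"
  det_step :: "'q \<Rightarrow> 'a tape_symbol \<Rightarrow> 'q \<times> move"

definition states :: "('q, 'a) pfa2 \<Rightarrow> 'q set" where
  "states M = coin_states M \<union> det_states M \<union> {accept M, reject M}"

definition tape_symbols :: "('q, 'a) pfa2 \<Rightarrow> 'a tape_symbol set" where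
  "tape_symbols M = {Left_End, Right_End} \<union> Letter ` alphabet M"

text \<open>The head may not leave the part of the tape delimited by the end-markers.\<close>

definition legal_move :: "'a tape_symbol \<Rightarrow> move \<Rightarrow> bool" where
  "legal_move s d \<longleftrightarrow> \<not> (s = Left_End \<and> d = Move_Left) \<and> \<not> (s = Right_End \<and> d = Move_Right)"

locale pfa2 =
  fixes M :: "('q, 'a) pfa2"
  assumes finite_alphabet: "finite (alphabet M)"
    and finite_states: "finite (states M)"
    and coin_det_disjoint: "coin_states M \<inter> det_states M = {}"
    and accept_halts: "accept M \<notin> coin_states M \<union> det_states M"
    and reject_halts: "reject M \<notin> coin_states M \<union> det_states M"
    and accept_neq_reject: "accept M \<noteq> reject M"
    and start_state: "start M \<in> states M"
    and coin_step_closed: "\<lbrakk>q \<in> coin_states M; s \<in> tape_symbols M; coin_step M q s b = (q', d)\<rbrakk>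
      \<Longrightarrow> q' \<in> states M \<and> legal_move s d"
    and det_step_closed: "\<lbrakk>q \<in> det_states M; s \<in> tape_symbols M; det_step M q s = (q', d)\<rbrakk>
      \<Longrightarrow> q' \<in> states M \<and> legal_move s d"

text \<open>
  On input \<open>x\<close>, position \<open>0\<close> holds the left end-marker, positions \<open>1, \<dots>, length x\<close> the letters
  of \<open>x\<close>, and position \<open>length x + 1\<close> the right end-marker.
\<close>

definition tape :: "'a list \<Rightarrow> nat \<Rightarrow> 'a tape_symbol" where
  "tape x i = (if i = 0 then Left_End else if i \<le> length x then Letter (x ! (i - 1)) else Right_End)"

fun move_head :: "move \<Rightarrow> nat \<Rightarrow> nat" where
  "move_head Move_Left i = i - 1"
| "move_head Stay i = i"
| "move_head Move_Right i = i + 1"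

text \<open>
  \<open>reaches M x c w c'\<close>: from configuration \<open>c\<close> (state and head position), some finite computation
  of \<open>M\<close> on \<open>x\<close> ends in \<open>c'\<close> and tosses exactly \<open>length w\<close> coins on its way, with the successive
  outcomes \<open>w\<close>. No rule applies to the accept and reject states, so these halt.
\<close>

inductive reaches :: "('q, 'a) pfa2 \<Rightarrow> 'a list \<Rightarrow> 'q \<times> nat \<Rightarrow> bool list \<Rightarrow> 'q \<times> nat \<Rightarrow> bool"
  for M :: "('q, 'a) pfa2" and x :: "'a list" where
  refl: "reaches M x c [] c"
| det: "\<lbrakk>q \<in> det_states M; det_step M q (tape x i) = (q', d);
    reaches M x (q', move_head d i) w c\<rbrakk> \<Longrightarrow> reaches M x (q, i) w c"
| coin: "\<lbrakk>q \<in> coin_states M; coin_step M q (tape x i) b = (q', d);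
    reaches M x (q', move_head d i) w c\<rbrakk> \<Longrightarrow> reaches M x (q, i) (b # w) c"

text \<open>
  A halting computational branch is determined by its sequence \<open>w\<close> of coin outcomes; since the coins
  are fair and independent, it is taken with probability \<open>(1/2) ^ length w\<close>.
\<close>

definition branches_to :: "('q, 'a) pfa2 \<Rightarrow> 'a list \<Rightarrow> 'q \<Rightarrow> bool list set" where
  "branches_to M x q = {w. \<exists>i. reaches M x (start M, 0) w (q, i)}"

definition accepting_branches :: "('q, 'a) pfa2 \<Rightarrow> 'a list \<Rightarrow> bool list set" where
  "accepting_branches M x = branches_to M x (accept M)"

definition rejecting_branches :: "('q, 'a) pfa2 \<Rightarrow> 'a list \<Rightarrow> bool list set" where
  "rejecting_branches M x = branches_to M x (reject M)"

definition halting_branches :: "('q, 'a) pfa2 \<Rightarrow> 'a list \<Rightarrow> bool list set" where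
  "halting_branches M x = accepting_branches M x \<union> rejecting_branches M x"

definition branch_prob :: "bool list \<Rightarrow> ennreal" where
  "branch_prob w = (1 / 2) ^ length w"

definition accept_prob :: "('q, 'a) pfa2 \<Rightarrow> 'a list \<Rightarrow> ennreal" where
  "accept_prob M x = (\<Sum>\<^sub>\<infinity>w\<in>accepting_branches M x. branch_prob w)"

definition reject_prob :: "('q, 'a) pfa2 \<Rightarrow> 'a list \<Rightarrow> ennreal" where
  "reject_prob M x = (\<Sum>\<^sub>\<infinity>w\<in>rejecting_branches M x. branch_prob w)"

text \<open>
  Non-halting computations contribute nothing to this expectation, and it is not normalised by the
  probability of halting. For bounded-error machines that probability exceeds \<open>1/2\<close>, so
  conditioning on halting would change the value by a factor of less than \<open>2\<close>.
\<close>

definition expected_coin_tosses :: "('q, 'a) pfa2 \<Rightarrow> 'a list \<Rightarrow> ennreal" where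
  "expected_coin_tosses M x = (\<Sum>\<^sub>\<infinity>w\<in>halting_branches M x. of_nat (length w) * branch_prob w)"

definition recognizes_bounded_error :: "('q, 'a) pfa2 \<Rightarrow> 'a list set \<Rightarrow> bool" where
  "recognizes_bounded_error M L \<longleftrightarrow> L \<subseteq> lists (alphabet M) \<and>
    (\<exists>\<epsilon>::real. \<epsilon> < 1 / 2 \<and> (\<forall>x\<in>lists (alphabet M).
      (x \<in> L \<longrightarrow> accept_prob M x \<ge> ennreal (1 - \<epsilon>)) \<and>
      (x \<notin> L \<longrightarrow> reject_prob M x \<ge> ennreal (1 - \<epsilon>))))"

text \<open>
  The branch probabilities above make sense because halting branches form a prefix-free set of coin
  sequences, each ending in a unique configuration.
\<close>

lemma (in pfa2) halting_branch_unique: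
  assumes "reaches M x c w c1" and "reaches M x c (w @ v) c2"
    and "fst c1 \<in> {accept M, reject M}" and "fst c2 \<in> {accept M, reject M}"
  shows "v = [] \<and> c1 = c2"
  using assms
proof (induction arbitrary: v rule: reaches.induct)
  case (refl c)
  from refl(1) show ?case
    by cases (use refl accept_halts reject_halts in auto)
next
  case (det q i q' d w c)
  from det.prems(1) show ?case
    by cases (use det accept_halts reject_halts coin_det_disjoint in auto)
next
  case (coin q i b q' d w c)
  from coin.prems(1) show ?case
    by cases (use coin accept_halts reject_halts coin_det_disjoint in auto)
qed

section \<open>Regular languages\<close>

text \<open>
  Acceptance by a deterministic finite automaton. Taking the states to be natural numbers is no
  restriction, since any finite set of states can be renamed.
\<close>

definition regular :: "'a set \<Rightarrow> 'a list set \<Rightarrow> bool" where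
  "regular \<Sigma> L \<longleftrightarrow> finite \<Sigma> \<and>
    (\<exists>(Q::nat set) q0 F \<delta>. finite Q \<and> q0 \<in> Q \<and> F \<subseteq> Q \<and>
      (\<forall>q\<in>Q. \<forall>a\<in>\<Sigma>. \<delta> q a \<in> Q) \<and> L = {w \<in> lists \<Sigma>. foldl \<delta> q0 w \<in> F})"

end

theory Submission imports Defs "HOL-Real_Asymp.Real_Asymp"
begin

text \<open>
  Cut an input \<open>x @ y\<close> at the boundary between \<open>x\<close> and \<open>y\<close>. The computation becomes a Markov chain whose
  number \<open>s\<close> of states depends only on \<open>M\<close> and whose rows depend either on \<open>x\<close> only or on \<open>y\<close> only.
  Absorption probabilities of such a chain are subtraction-free rational functions of its entries and
  of the row defects, so changing all of these by factors in \<open>[1 / \<beta>, \<beta>]\<close> changes the acceptance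
  probability by a factor of at most \<open>\<beta> ^ 3 ^ s\<close>, however long the chain runs.

  Between two coin tosses a halting computation need not repeat a configuration. Polynomially many
  expected coin tosses therefore allow us to ignore all runs longer than some polynomial in the input
  length \<open>n\<close>, and then also all entries below some inverse polynomial \<open>\<delta>\<close>. The
  logarithms of the remaining entries, rounded to multiples of \<open>ln \<beta>\<close>, take only \<open>O(ln n)\<close> values, so
  the words \<open>x\<close> fall into polylogarithmically many classes that no \<open>y\<close> with total length at most \<open>n\<close> can
  separate with respect to \<open>L\<close>.

  The classes for \<open>n\<close> yield a finite automaton that agrees with \<open>L\<close> up to length \<open>n\<close>. The automata for \<open>n\<close>
  and \<open>n + 1\<close> agree up to length \<open>n\<close>, which exceeds the product of their numbers of states, so they are
  equivalent. Hence all large \<open>n\<close> give the same language, which is \<open>L\<close>.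
\<close>

section \<open>Languages with few indistinguishability classes\<close>

lemma regularI_finite_automaton:
  fixes \<delta> :: "'s \<Rightarrow> 'a \<Rightarrow> 's"
  assumes "finite \<Sigma>" "finite Q" "qi \<in> Q" "F \<subseteq> Q"
    and closed: "\<And>q a. q \<in> Q \<Longrightarrow> a \<in> \<Sigma> \<Longrightarrow> \<delta> q a \<in> Q"
    and L: "L = {w \<in> lists \<Sigma>. foldl \<delta> qi w \<in> F}"
  shows "regular \<Sigma> L"
proof -
  obtain e :: "'s \<Rightarrow> nat" where e: "inj_on e Q"
    using finite_imp_inj_to_nat_seg[OF assms(2)] by blast
  define d where "d = inv_into Q e"
  have de: "d (e q) = q" if "q \<in> Q" for q
    using e that by (simp add: d_def)
  define \<delta>' where "\<delta>' m a = e (\<delta> (d m) a)" for m a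
  have run: "foldl \<delta>' (e q) w = e (foldl \<delta> q w) \<and> foldl \<delta> q w \<in> Q"
    if "q \<in> Q" "w \<in> lists \<Sigma>" for q w
    using that
  proof (induction w arbitrary: q)
    case (Cons a w)
    then show ?case using closed by (simp add: \<delta>'_def de)
  qed simp
  have "L = {w \<in> lists \<Sigma>. foldl \<delta>' (e qi) w \<in> e ` F}"
  proof -
    have "foldl \<delta>' (e qi) w \<in> e ` F \<longleftrightarrow> foldl \<delta> qi w \<in> F" if "w \<in> lists \<Sigma>" for w
      using run[OF assms(3) that] inj_on_image_mem_iff[OF e _ assms(4)] by simp
    then show ?thesis unfolding L by blast
  qed
  moreover have "\<forall>q\<in>e ` Q. \<forall>a\<in>\<Sigma>. \<delta>' q a \<in> e ` Q"
    using closed by (auto simp: \<delta>'_def de)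
  ultimately show ?thesis
    unfolding regular_def using assms
    by (intro conjI exI[of _ "e ` Q"] exI[of _ "e qi"] exI[of _ "e ` F"] exI[of _ \<delta>']) auto
qed

text \<open>By pigeonhole, a run on a word of length at least \<open>card Q\<close> visits some
  state twice; cutting out the loop in between keeps the final state and shortens the word.\<close>

lemma short_witness:
  fixes \<delta> :: "'s \<Rightarrow> 'a \<Rightarrow> 's"
  assumes "finite Q" "q0 \<in> Q"
    and closed: "\<And>q a. q \<in> Q \<Longrightarrow> a \<in> \<Sigma> \<Longrightarrow> \<delta> q a \<in> Q"
    and "w \<in> lists \<Sigma>" "P (foldl \<delta> q0 w)"
  shows "\<exists>w\<in>lists \<Sigma>. length w < card Q \<and> P (foldl \<delta> q0 w)"
  using assms(4,5)
proof (induction "length w" arbitrary: w rule: less_induct)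
  case less
  show ?case
  proof (cases "length w < card Q")
    case False
    define f where "f i = foldl \<delta> q0 (take i w)" for i
    have inQ: "foldl \<delta> q v \<in> Q" if "q \<in> Q" "v \<in> lists \<Sigma>" for q v
      using that by (induction v arbitrary: q) (auto simp: closed)
    have sub: "f ` {..length w} \<subseteq> Q"
      using inQ[OF assms(2)] less.prems(1) by (auto simp: f_def dest: in_set_takeD)
    have "\<not> inj_on f {..length w}"
    proof
      assume "inj_on f {..length w}"
      then have "card {..length w} \<le> card Q"
        using card_inj_on_le[OF _ sub assms(1)] by blast
      with False show False by simp
    qed
    then obtain i j where ij: "i < j" "j \<le> length w" "f i = f j"
      unfolding inj_on_def by (auto, metis linorder_neqE_nat)
    define w' where "w' = take i w @ drop j w"
    have "foldl \<delta> q0 w' = foldl \<delta> (f j) (drop j w)"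
      by (simp add: w'_def f_def[symmetric] ij(3))
    also have "\<dots> = foldl \<delta> q0 w"
      by (metis append_take_drop_id f_def foldl_append)
    finally have "P (foldl \<delta> q0 w')" using less.prems(2) by simp
    moreover have "w' \<in> lists \<Sigma>"
      using less.prems(1) by (auto simp: w'_def dest: in_set_takeD in_set_dropD)
    moreover have "length w' < length w" using ij by (simp add: w'_def)
    ultimately show ?thesis using less.hyps by blast
  qed (use less.prems in blast)
qed

text \<open>The classes of \<open>\<kappa> n\<close> need not form a right congruence, so the
  automaton on them continues from chosen representatives. It is correct up to length
  \<open>n\<close>, and the bound on the product of class numbers makes the automata for
  \<open>n\<close> and \<open>Suc n\<close> equivalent.\<close>

lemma regular_if_few_classes:
  fixes \<kappa> :: "nat \<Rightarrow> 'a list \<Rightarrow> 'c"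
  assumes fin: "finite \<Sigma>" and L: "L \<subseteq> lists \<Sigma>"
    and fink: "\<And>n. n \<ge> N \<Longrightarrow> finite (\<kappa> n ` lists \<Sigma>)"
    and cardk: "\<And>n. n \<ge> N \<Longrightarrow> card (\<kappa> n ` lists \<Sigma>) * card (\<kappa> (Suc n) ` lists \<Sigma>) \<le> n"
    and sim: "\<And>n x x' v. n \<ge> N \<Longrightarrow> x \<in> lists \<Sigma> \<Longrightarrow> x' \<in> lists \<Sigma> \<Longrightarrow> v \<in> lists \<Sigma> \<Longrightarrow>
      \<kappa> n x = \<kappa> n x' \<Longrightarrow> length (x @ v) \<le> n \<Longrightarrow> length (x' @ v) \<le> n \<Longrightarrow> x @ v \<in> L \<Longrightarrow> x' @ v \<in> L"
  shows "regular \<Sigma> L"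
proof -
  \<comment> \<open>Representatives have minimal length, so replacing a prefix by its representative
    never lengthens a word and the length bounds in \<open>sim\<close> persist along a run.\<close>
  define rep where "rep n c = arg_min length (\<lambda>x. x \<in> lists \<Sigma> \<and> \<kappa> n x = c)" for n c
  define Q where "Q n = \<kappa> n ` lists \<Sigma>" for n
  define \<delta> where "\<delta> n c a = \<kappa> n (rep n c @ [a])" for n c a
  define st where "st n w = foldl (\<delta> n) (\<kappa> n []) w" for n w
  define acc where "acc n w \<longleftrightarrow> rep n (st n w) \<in> L" for n w
  have rep: "rep n c \<in> lists \<Sigma>" "\<kappa> n (rep n c) = c" if "c \<in> Q n" for n c
  proof -
    from that obtain x where "x \<in> lists \<Sigma> \<and> \<kappa> n x = c" by (auto simp: Q_def)
    from arg_min_natI[of "\<lambda>x. x \<in> lists \<Sigma> \<and> \<kappa> n x = c", OF this, of length]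
    show "rep n c \<in> lists \<Sigma>" "\<kappa> n (rep n c) = c" by (auto simp: rep_def)
  qed
  have rep_le: "length (rep n (\<kappa> n x)) \<le> length x" if "x \<in> lists \<Sigma>" for n x
    unfolding rep_def using that by (intro arg_min_nat_le) auto
  have q0: "\<kappa> n [] \<in> Q n" for n by (simp add: Q_def)
  have closed: "\<delta> n c a \<in> Q n" if "c \<in> Q n" "a \<in> \<Sigma>" for n c a
    using rep[OF that(1)] that by (auto simp: \<delta>_def Q_def)
  \<comment> \<open>A length-bounded Nerode equivalence between the prefix read so far and its
    representative. The induction step uses it for \<open>a # v\<close> and then applies
    \<open>sim\<close> once in each direction.\<close>
  have st: "st n w \<in> Q n \<and> length (rep n (st n w)) \<le> length w \<and>
      (\<forall>v\<in>lists \<Sigma>. n \<ge> N \<longrightarrow> length (w @ v) \<le> n \<longrightarrow> (w @ v \<in> L \<longleftrightarrow> rep n (st n w) @ v \<in> L))"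
    if "w \<in> lists \<Sigma>" for n w
    using that
  proof (induction w rule: rev_induct)
    case Nil
    then show ?case using q0 rep_le[of "[]" n] by (simp add: st_def)
  next
    case (snoc a w)
    then have w: "w \<in> lists \<Sigma>" and a: "a \<in> \<Sigma>" by auto
    note IH = snoc.IH[OF w]
    let ?r = "rep n (st n w)"
    let ?s = "st n (w @ [a])"
    have s: "?s = \<kappa> n (?r @ [a])" by (simp add: st_def \<delta>_def)
    have ra: "?r @ [a] \<in> lists \<Sigma>" using rep(1)[of "st n w" n] IH a by auto
    have sQ: "?s \<in> Q n" using ra by (auto simp: s Q_def)
    have len: "length (rep n ?s) \<le> length (?r @ [a])" using rep_le[OF ra] by (simp add: s)
    have "w @ a # v \<in> L \<longleftrightarrow> rep n ?s @ v \<in> L"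
      if "v \<in> lists \<Sigma>" "n \<ge> N" "length ((w @ [a]) @ v) \<le> n" for v
    proof -
      have "w @ a # v \<in> L \<longleftrightarrow> (?r @ [a]) @ v \<in> L"
        using IH that a by auto
      also have "\<dots> \<longleftrightarrow> rep n ?s @ v \<in> L"
      proof -
        have 1: "\<kappa> n (rep n ?s) = \<kappa> n (?r @ [a])" using rep(2)[OF sQ] s by simp
        have 2: "length ((?r @ [a]) @ v) \<le> n" "length (rep n ?s @ v) \<le> n"
          using IH that len by auto
        show ?thesis
          using sim[OF that(2) ra rep(1)[OF sQ] that(1) 1[symmetric] 2]
            sim[OF that(2) rep(1)[OF sQ] ra that(1) 1 2(2,1)] by blast
      qed
      finally show ?thesis .
    qed
    then show ?case using sQ len IH by auto
  qed
  have acc_short: "acc n w \<longleftrightarrow> w \<in> L" if "n \<ge> N" "w \<in> lists \<Sigma>" "length w \<le> n" for n w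
    using st[OF that(2), of n] that by (auto simp: acc_def dest: bspec[of _ _ "[]"])
  \<comment> \<open>Product construction: if the two automata differed, they would differ on a word
    shorter than the number of pairs of states, hence of length at most \<open>n\<close>, where both
    agree with \<open>L\<close>.\<close>
  have acc_Suc: "acc (Suc n) w \<longleftrightarrow> acc n w" if n: "n \<ge> N" and w: "w \<in> lists \<Sigma>" for n w
  proof (rule ccontr)
    assume neq: "\<not> ?thesis"
    let ?d = "\<lambda>(c, c') a. (\<delta> n c a, \<delta> (Suc n) c' a)"
    let ?q = "(\<kappa> n [], \<kappa> (Suc n) [])"
    define P where "P = (\<lambda>(c, c'). \<not> (rep (Suc n) c' \<in> L \<longleftrightarrow> rep n c \<in> L))"
    have pair: "foldl ?d (c, c') w = (foldl (\<delta> n) c w, foldl (\<delta> (Suc n)) c' w)" for c c' w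
      by (induction w arbitrary: c c') auto
    have iff: "P (foldl ?d ?q w) \<longleftrightarrow> \<not> (acc (Suc n) w \<longleftrightarrow> acc n w)" for w
      by (simp add: pair P_def acc_def st_def)
    have "\<exists>w\<in>lists \<Sigma>. length w < card (Q n \<times> Q (Suc n)) \<and> P (foldl ?d ?q w)"
    proof (rule short_witness)
      show "finite (Q n \<times> Q (Suc n))" using fink n by (simp add: Q_def)
      show "P (foldl ?d ?q w)" using neq iff by blast
    qed (use q0 closed w in auto)
    then obtain w' where w': "w' \<in> lists \<Sigma>" "length w' < card (Q n \<times> Q (Suc n))"
      "\<not> (acc (Suc n) w' \<longleftrightarrow> acc n w')" by (auto simp: iff)
    have "length w' \<le> n" using w'(2) cardk[OF n] by (simp add: card_cartesian_product Q_def)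
    then show False using w' acc_short[of n w'] acc_short[of "Suc n" w'] n by auto
  qed
  have acc_eq: "acc (N + k) w \<longleftrightarrow> acc N w" if "w \<in> lists \<Sigma>" for k w
    by (induction k) (use acc_Suc that in auto)
  have "L = {w \<in> lists \<Sigma>. foldl (\<delta> N) (\<kappa> N []) w \<in> {c \<in> Q N. rep N c \<in> L}}"
  proof -
    \<comment> \<open>The automaton for \<open>N + length w\<close> is right about \<open>w\<close>,
      and it is equivalent to the one for \<open>N\<close>.\<close>
    have "w \<in> L \<longleftrightarrow> acc N w" if "w \<in> lists \<Sigma>" for w
      using acc_short[of "N + length w" w] acc_eq[OF that] that by simp
    moreover have "st N w \<in> Q N" if "w \<in> lists \<Sigma>" for w using st[OF that] by blast
    ultimately show ?thesis using L unfolding acc_def st_def by blast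
  qed
  then show ?thesis
    using fin fink[of N] closed[of _ N] q0[of N]
    by (intro regularI_finite_automaton[where Q = "Q N" and \<delta> = "\<delta> N" and qi = "\<kappa> N []"
          and F = "{c \<in> Q N. rep N c \<in> L}"]) (auto simp: Q_def)
qed

section \<open>Perturbation of absorption probabilities\<close>

text \<open>Stated with products and not with quotients, so that zero entries are covered: no
  positive number is close to zero.\<close>

definition mclose :: "real \<Rightarrow> real \<Rightarrow> real \<Rightarrow> bool" where
  "mclose \<beta> u v \<longleftrightarrow> u \<le> \<beta> * v \<and> v \<le> \<beta> * u"

lemma mclose_add: "mclose \<beta> u v \<Longrightarrow> mclose \<beta> u' v' \<Longrightarrow> mclose \<beta> (u + u') (v + v')"
  by (auto simp: mclose_def algebra_simps)

lemma mclose_sum: "(\<And>i. i \<in> I \<Longrightarrow> mclose \<beta> (f i) (g i)) \<Longrightarrow> mclose \<beta> (sum f I) (sum g I)"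
  by (auto simp: mclose_def sum_distrib_left intro!: sum_mono)

lemma mclose_nonneg: "mclose \<beta> u v \<Longrightarrow> 0 \<le> u \<Longrightarrow> 1 \<le> \<beta> \<Longrightarrow> 0 \<le> v"
  unfolding mclose_def using mult_pos_neg[of \<beta> v] by linarith

lemma mclose_pos: "mclose \<beta> u v \<Longrightarrow> 0 < u \<Longrightarrow> 1 \<le> \<beta> \<Longrightarrow> 0 < v"
  unfolding mclose_def using mult_nonneg_nonpos[of \<beta> v] by linarith

lemma mclose_power_mono:
  assumes "mclose \<beta> u v" "0 \<le> u" "1 \<le> \<beta>" "1 \<le> n"
  shows "mclose (\<beta> ^ n) u v"
proof -
  have "0 \<le> v" using assms mclose_nonneg by blast
  moreover have "\<beta> \<le> \<beta> ^ n" using assms(3,4) by (simp add: self_le_power)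
  ultimately have "\<beta> * v \<le> \<beta> ^ n * v" "\<beta> * u \<le> \<beta> ^ n * u" using assms by (auto intro: mult_right_mono)
  then show ?thesis using assms by (auto simp: mclose_def)
qed

lemma mult_div_le:
  fixes \<beta> :: real
  assumes "x \<le> \<beta> * x'" "y \<le> \<beta> * y'" "w' \<le> \<beta> * w" "0 \<le> x" "0 \<le> y" "0 < w" "0 < w'" "0 < \<beta>"
    and "0 \<le> x'" "0 \<le> y'"
  shows "x * y / w \<le> \<beta> ^ 3 * (x' * y' / w')"
proof -
  have "x * y \<le> (\<beta> * x') * (\<beta> * y')" using assms by (intro mult_mono) auto
  then have "x * y * w' \<le> ((\<beta> * x') * (\<beta> * y')) * (\<beta> * w)"
    using assms by (intro mult_mono) auto
  then show ?thesis using assms by (simp add: field_simps power3_eq_cube)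
qed

text \<open>Three factors, each off by at most \<open>\<beta>\<close>; this is where the cubing per
  eliminated state comes from.\<close>

lemma mclose_mult_div:
  assumes "mclose \<beta> x x'" "mclose \<beta> y y'" "mclose \<beta> w w'" "0 \<le> x" "0 \<le> y" "0 < w" "1 \<le> \<beta>"
  shows "mclose (\<beta> ^ 3) (x * y / w) (x' * y' / w')"
proof -
  have "0 \<le> x'" "0 \<le> y'" "0 < w'" using assms mclose_nonneg mclose_pos by blast+
  then show ?thesis using assms unfolding mclose_def by (intro conjI mult_div_le) auto
qed

text \<open>One state is eliminated at a time; the elimination step contains no subtraction, so it only
  cubes the multiplicative error.\<close>

lemma absorption_prob_perturb:
  fixes P P' :: "'i \<Rightarrow> 'i \<Rightarrow> real"
  assumes "finite S" "card S = Suc n" "t \<in> S" "1 \<le> \<beta>"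
    and "\<And>i j. i \<in> S \<Longrightarrow> j \<in> S \<Longrightarrow> 0 \<le> P i j \<and> mclose \<beta> (P i j) (P' i j)"
    and "\<And>i. i \<in> S \<Longrightarrow> 0 \<le> a i \<and> mclose \<beta> (a i) (a' i)"
    and "\<And>i. i \<in> S \<Longrightarrow> 0 < d i \<and> mclose \<beta> (d i) (d' i)"
    and "\<And>i. i \<in> S \<Longrightarrow> (a i + d i + (\<Sum>j\<in>S. P i j)) * h i = a i + (\<Sum>j\<in>S. P i j * h j)"
    and "\<And>i. i \<in> S \<Longrightarrow> (a' i + d' i + (\<Sum>j\<in>S. P' i j)) * h' i = a' i + (\<Sum>j\<in>S. P' i j * h' j)"
  shows "h t \<le> \<beta> ^ 3 ^ Suc n * h' t"
  using assms
proof (induction n arbitrary: S P P' a a' d d' \<beta>)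
  case 0
  then have S: "S = {t}" by (metis One_nat_def card_1_singletonE singletonD)
  have a: "0 \<le> a t" "mclose \<beta> (a t) (a' t)" and d: "0 < d t" "mclose \<beta> (d t) (d' t)"
    using 0 by auto
  have h: "(a t + d t) * h t = a t" and h': "(a' t + d' t) * h' t = a' t"
    using 0(8,9)[of t] S by (auto simp: algebra_simps)
  have pos: "0 < a t + d t" "0 < a' t + d' t"
    using a d mclose_nonneg[OF a(2)] mclose_pos[OF d(2)] 0(4) by auto
  then have "h t = a t * 1 / (a t + d t)" "h' t = a' t * 1 / (a' t + d' t)"
    using h h' by (simp_all add: field_simps)
  moreover have "mclose \<beta> 1 1" using 0(4) by (simp add: mclose_def)
  ultimately have "mclose (\<beta> ^ 3) (h t) (h' t)"
    using mclose_mult_div[OF a(2) _ mclose_add[OF a(2) d(2)] a(1) _ pos(1) 0(4), of 1 1] by simp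
  then show ?case by (simp add: mclose_def)
next
  case (Suc n)
  note fin = Suc.prems(1) and beta = Suc.prems(4) and P = Suc.prems(5) and a = Suc.prems(6)
    and d = Suc.prems(7) and h = Suc.prems(8) and h' = Suc.prems(9)
  obtain s where s: "s \<in> S" "s \<noteq> t"
  proof -
    have "S - {t} \<noteq> {}" using Suc.prems(2,3) fin card_Diff_singleton[of t S] by force
    then show ?thesis using that by blast
  qed
  define S' where "S' = S - {s}"
  have sum_S: "sum f S = f s + sum f S'" for f :: "'i \<Rightarrow> real"
    unfolding S'_def using fin s by (simp add: sum.remove)
  \<comment> \<open>The weight of leaving \<open>s\<close> other than by its self-loop. As a sum of
    nonnegative entries, rather than one minus the loop, it inherits the factor
    \<open>\<beta>\<close>.\<close>
  define W where "W = a s + d s + (\<Sum>j\<in>S'. P s j)"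
  define W' where "W' = a' s + d' s + (\<Sum>j\<in>S'. P' s j)"
  have "0 \<le> (\<Sum>j\<in>S'. P s j)" using P s by (auto simp: S'_def intro!: sum_nonneg)
  then have W: "0 < W" using a[OF s(1)] d[OF s(1)] by (simp add: W_def)
  have WW': "mclose \<beta> W W'"
    unfolding W_def W'_def using P a d s by (intro mclose_add mclose_sum) (auto simp: S'_def)
  have W': "0 < W'" using mclose_pos[OF WW' W beta] .
  have cube: "mclose (\<beta> ^ 3) (u + x * y / W) (u' + x' * y' / W')"
    if "mclose \<beta> u u'" "0 \<le> u" "mclose \<beta> x x'" "0 \<le> x" "mclose \<beta> y y'" "0 \<le> y" for u u' x x' y y'
    using mclose_power_mono[OF that(1,2) beta, of 3] mclose_mult_div[OF that(3,5) WW' that(4,6) W beta]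
    by (auto intro: mclose_add)
  \<comment> \<open>Substituting the equation for \<open>g s\<close> redistributes
    \<open>p i s\<close> over absorption, loss and \<open>S'\<close> in proportions that add up to
    1; the self-loop at \<open>s\<close> cancels. The coefficients are arbitrary because both chains
    undergo this step.\<close>
  have eliminate: "(a i + p i s * a s / V + (d i + p i s * d s / V) + (\<Sum>j\<in>S'. p i j + p i s * p s j / V)) * g i
      = a i + p i s * a s / V + (\<Sum>j\<in>S'. (p i j + p i s * p s j / V) * g j)"
    if g: "\<And>i. i \<in> S \<Longrightarrow> (a i + d i + (\<Sum>j\<in>S. p i j)) * g i = a i + (\<Sum>j\<in>S. p i j * g j)"
      and V: "V = a s + d s + (\<Sum>j\<in>S'. p s j)" "0 < V" and i: "i \<in> S'"
    for a d g :: "'i \<Rightarrow> real" and p V i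
  proof -
    have "V * g s = a s + (\<Sum>j\<in>S'. p s j * g j)"
      using g[OF s(1)] by (simp add: V(1) sum_S algebra_simps)
    then have gs: "g s = (a s + (\<Sum>j\<in>S'. p s j * g j)) / V" using V(2) by (simp add: field_simps)
    have 1: "(\<Sum>j\<in>S'. p i j + p i s * p s j / V) = (\<Sum>j\<in>S'. p i j) + p i s * (\<Sum>j\<in>S'. p s j) / V"
      by (simp add: sum.distrib sum_distrib_left sum_divide_distrib)
    have 2: "a i + p i s * a s / V + (d i + p i s * d s / V) + (\<Sum>j\<in>S'. p i j + p i s * p s j / V)
        = a i + d i + (\<Sum>j\<in>S'. p i j) + p i s * (V / V)"
    proof -
      have "p i s * a s / V + p i s * d s / V + p i s * (\<Sum>j\<in>S'. p s j) / V = p i s * (V / V)"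
        unfolding add_divide_distrib[symmetric] distrib_left[symmetric] V(1)[symmetric] by simp
      then show ?thesis unfolding 1 by simp
    qed
    have 3: "(\<Sum>j\<in>S'. (p i j + p i s * p s j / V) * g j)
        = (\<Sum>j\<in>S'. p i j * g j) + p i s * ((\<Sum>j\<in>S'. p s j * g j) / V)"
      by (simp add: sum.distrib sum_distrib_left sum_divide_distrib algebra_simps)
    have iS: "i \<in> S" using i by (simp add: S'_def)
    have "(a i + d i + (\<Sum>j\<in>S'. p i j) + p i s * (V / V)) * g i
        = (a i + d i + (\<Sum>j\<in>S. p i j)) * g i"
      using V(2) by (simp add: sum_S algebra_simps)
    also have "\<dots> = a i + (\<Sum>j\<in>S'. p i j * g j) + p i s * g s"
      using g[OF iS] by (simp add: sum_S)
    finally show ?thesis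
      unfolding 2 3 gs by (simp add: algebra_simps add_divide_distrib)
  qed
  \<comment> \<open>The reduced chains have one state less and error factor
    \<open>\<beta> ^ 3\<close>, which supplies the missing power of 3 in the exponent.\<close>
  have "h t \<le> (\<beta> ^ 3) ^ 3 ^ Suc n * h' t"
  proof (rule Suc.IH[where P = "\<lambda>i j. P i j + P i s * P s j / W" and P' = "\<lambda>i j. P' i j + P' i s * P' s j / W'"
        and a = "\<lambda>i. a i + P i s * a s / W" and a' = "\<lambda>i. a' i + P' i s * a' s / W'"
        and d = "\<lambda>i. d i + P i s * d s / W" and d' = "\<lambda>i. d' i + P' i s * d' s / W'"])
    show "finite S'" "card S' = Suc n" "t \<in> S'" "1 \<le> \<beta> ^ 3"
      using fin s Suc.prems(2,3) beta by (auto simp: S'_def)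
    show "0 \<le> P i j + P i s * P s j / W \<and>
        mclose (\<beta> ^ 3) (P i j + P i s * P s j / W) (P' i j + P' i s * P' s j / W')"
      if "i \<in> S'" "j \<in> S'" for i j
      using that P s W by (intro conjI cube) (auto simp: S'_def)
    show "0 \<le> a i + P i s * a s / W \<and>
        mclose (\<beta> ^ 3) (a i + P i s * a s / W) (a' i + P' i s * a' s / W')"
      if "i \<in> S'" for i
      using that P a s W by (intro conjI cube) (auto simp: S'_def)
    show "0 < d i + P i s * d s / W \<and>
        mclose (\<beta> ^ 3) (d i + P i s * d s / W) (d' i + P' i s * d' s / W')"
      if "i \<in> S'" for i
      using that P d[of i] d[of s] s W
      by (intro conjI cube add_pos_nonneg) (auto simp: S'_def)
  qed (use eliminate[where a = a and d = d and p = P and g = h, OF _ W_def W] h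
      eliminate[where a = a' and d = d' and p = P' and g = h', OF _ W'_def W'] h' in auto)
  then show ?case by (simp add: power_mult[symmetric])
qed

text \<open>Probability of absorption within \<open>k\<close> transitions. The absorbing transition
  itself is counted, so one step already yields \<open>a\<close>.\<close>

primrec absorb :: "'i set \<Rightarrow> ('i \<Rightarrow> 'i \<Rightarrow> real) \<Rightarrow> ('i \<Rightarrow> real) \<Rightarrow> nat \<Rightarrow> 'i \<Rightarrow> real" where
  "absorb S P a 0 i = 0"
| "absorb S P a (Suc k) i = a i + (\<Sum>j\<in>S. P i j * absorb S P a k j)"

definition substochastic :: "'i set \<Rightarrow> ('i \<Rightarrow> 'i \<Rightarrow> real) \<Rightarrow> ('i \<Rightarrow> real) \<Rightarrow> bool" where
  "substochastic S P a \<longleftrightarrow> (\<forall>i\<in>S. (\<forall>j\<in>S. 0 \<le> P i j) \<and> 0 \<le> a i \<and> a i + (\<Sum>j\<in>S. P i j) \<le> 1)"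

text \<open>The loss weight \<open>d\<close> of \<open>absorption_prob_perturb\<close>; with it the
  coefficient of \<open>h i\<close> there becomes 1.\<close>

definition defect :: "'i set \<Rightarrow> ('i \<Rightarrow> 'i \<Rightarrow> real) \<Rightarrow> ('i \<Rightarrow> real) \<Rightarrow> 'i \<Rightarrow> real" where
  "defect S P a i = 1 - a i - (\<Sum>j\<in>S. P i j)"

text \<open>The factor \<open>1 - \<delta>\<close> leaves a defect of at least \<open>\<delta>\<close> in every row, so that defects, too, are
  bounded away from zero.\<close>

definition clip :: "real \<Rightarrow> real \<Rightarrow> real" where
  "clip \<delta> v = (if v < \<delta> then 0 else (1 - \<delta>) * v)"

lemma absorb_nonneg:
  assumes "substochastic S P a" "i \<in> S"
  shows "0 \<le> absorb S P a k i"
  using assms(2)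
  by (induction k arbitrary: i)
    (use assms(1) in \<open>auto simp: substochastic_def intro!: add_nonneg_nonneg sum_nonneg mult_nonneg_nonneg\<close>)

text \<open>Induction on \<open>k\<close>, as the one-step map is monotone. Limiting acceptance
  probabilities of the automaton will enter as such an \<open>h\<close>.\<close>

lemma absorb_le_supersolution:
  assumes "substochastic S P a" "i \<in> S"
    and h: "\<And>i. i \<in> S \<Longrightarrow> 0 \<le> h i" "\<And>i. i \<in> S \<Longrightarrow> a i + (\<Sum>j\<in>S. P i j * h j) \<le> h i"
  shows "absorb S P a k i \<le> h i"
  using assms(2)
proof (induction k arbitrary: i)
  case (Suc k)
  have "(\<Sum>j\<in>S. P i j * absorb S P a k j) \<le> (\<Sum>j\<in>S. P i j * h j)"
    using Suc assms(1) by (intro sum_mono mult_left_mono) (auto simp: substochastic_def)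
  then show ?case using h(2)[OF Suc.prems] by simp
qed (use h in auto)

lemma absorb_le_1:
  assumes "substochastic S P a" "i \<in> S"
  shows "absorb S P a k i \<le> 1"
  by (rule absorb_le_supersolution[OF assms]) (use assms(1) in \<open>auto simp: substochastic_def\<close>)

lemma absorb_mono:
  assumes "substochastic S P a" "i \<in> S"
  shows "absorb S P a k i \<le> absorb S P a (Suc k) i"
  using assms(2)
proof (induction k arbitrary: i)
  case 0
  then show ?case using assms(1) by (auto simp: substochastic_def)
next
  case (Suc k)
  have "(\<Sum>j\<in>S. P i j * absorb S P a k j) \<le> (\<Sum>j\<in>S. P i j * absorb S P a (Suc k) j)"
    using Suc assms(1) by (intro sum_mono mult_left_mono) (auto simp: substochastic_def)
  then show ?case by simp
qed

text \<open>A bounded increasing sequence converges, and its limit solves the equation by continuity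
  of the one-step map. The last property says that the limit is the least upper bound.\<close>

lemma absorb_fixpoint:
  assumes sub: "substochastic S P a"
  obtains h where "\<And>i. i \<in> S \<Longrightarrow> h i = a i + (\<Sum>j\<in>S. P i j * h j)"
    "\<And>i k. i \<in> S \<Longrightarrow> absorb S P a k i \<le> h i"
    "\<And>i b. i \<in> S \<Longrightarrow> (\<And>k. absorb S P a k i \<le> b) \<Longrightarrow> h i \<le> b"
proof -
  define h where "h i = (SUP k. absorb S P a k i)" for i
  have bdd: "bdd_above (range (\<lambda>k. absorb S P a k i))" if "i \<in> S" for i
    using absorb_le_1[OF sub that] by (intro bdd_aboveI[of _ 1]) auto
  have lim: "(\<lambda>k. absorb S P a k i) \<longlonglongrightarrow> h i" if "i \<in> S" for i
    unfolding h_def using absorb_mono[OF sub that] bdd[OF that]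
    by (intro LIMSEQ_incseq_SUP incseq_SucI) auto
  have "h i = a i + (\<Sum>j\<in>S. P i j * h j)" if "i \<in> S" for i
  proof (rule LIMSEQ_unique)
    show "(\<lambda>k. absorb S P a (Suc k) i) \<longlonglongrightarrow> h i" using lim[OF that] by (rule LIMSEQ_Suc)
    show "(\<lambda>k. absorb S P a (Suc k) i) \<longlonglongrightarrow> a i + (\<Sum>j\<in>S. P i j * h j)"
      unfolding absorb.simps by (intro tendsto_intros lim)
  qed
  moreover have "absorb S P a k i \<le> h i" if "i \<in> S" for i k
    unfolding h_def using bdd[OF that] by (rule cSUP_upper2) auto
  moreover have "h i \<le> b" if "i \<in> S" "\<And>k. absorb S P a k i \<le> b" for i b
    unfolding h_def using that by (intro cSUP_least) auto
  ultimately show ?thesis using that by blast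
qed

section \<open>Chains with small entries removed\<close>

lemma clip_nonneg: "0 \<le> v \<Longrightarrow> \<delta> \<le> 1 \<Longrightarrow> 0 \<le> clip \<delta> v"
  by (simp add: clip_def)

lemma clip_le: "0 \<le> v \<Longrightarrow> \<delta> \<le> 1 \<Longrightarrow> clip \<delta> v \<le> (1 - \<delta>) * v"
  by (simp add: clip_def)

lemma clip_le_self: "0 \<le> v \<Longrightarrow> 0 \<le> \<delta> \<Longrightarrow> \<delta> \<le> 1 \<Longrightarrow> clip \<delta> v \<le> v"
  by (auto simp: clip_def mult_left_le_one_le)

text \<open>Each clipped entry is at most \<open>1 - \<delta>\<close> times the original one, so a
  clipped row sums to at most \<open>1 - \<delta>\<close>.\<close>

lemma defect_clip:
  assumes "substochastic S P a" "i \<in> S" "0 < \<delta>" "\<delta> \<le> 1"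
  shows "\<delta> \<le> defect S (\<lambda>i j. clip \<delta> (P i j)) (\<lambda>i. clip \<delta> (a i)) i"
    and "defect S (\<lambda>i j. clip \<delta> (P i j)) (\<lambda>i. clip \<delta> (a i)) i \<le> 1"
proof -
  have nn: "0 \<le> a i" "\<And>j. j \<in> S \<Longrightarrow> 0 \<le> P i j" "a i + (\<Sum>j\<in>S. P i j) \<le> 1"
    using assms by (auto simp: substochastic_def)
  have "clip \<delta> (a i) + (\<Sum>j\<in>S. clip \<delta> (P i j)) \<le> (1 - \<delta>) * a i + (\<Sum>j\<in>S. (1 - \<delta>) * P i j)"
    using nn assms by (intro add_mono sum_mono clip_le) auto
  also have "\<dots> = (1 - \<delta>) * (a i + (\<Sum>j\<in>S. P i j))" by (simp add: sum_distrib_left algebra_simps)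
  also have "\<dots> \<le> 1 - \<delta>" using nn(3) assms(4) mult_left_mono[OF nn(3), of "1 - \<delta>"] by simp
  finally show "\<delta> \<le> defect S (\<lambda>i j. clip \<delta> (P i j)) (\<lambda>i. clip \<delta> (a i)) i" by (simp add: defect_def)
  have "0 \<le> (\<Sum>j\<in>S. clip \<delta> (P i j))" using nn assms by (intro sum_nonneg clip_nonneg) auto
  then show "defect S (\<lambda>i j. clip \<delta> (P i j)) (\<lambda>i. clip \<delta> (a i)) i \<le> 1"
    using clip_nonneg[OF nn(1) assms(4)] by (simp add: defect_def)
qed

lemma substochastic_clip:
  assumes "substochastic S P a" "0 < \<delta>" "\<delta> \<le> 1"
  shows "substochastic S (\<lambda>i j. clip \<delta> (P i j)) (\<lambda>i. clip \<delta> (a i))"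
  unfolding substochastic_def
proof (intro ballI conjI)
  fix i assume i: "i \<in> S"
  show "clip \<delta> (a i) + (\<Sum>j\<in>S. clip \<delta> (P i j)) \<le> 1"
    using defect_clip(1)[OF assms(1) i assms(2,3)] assms(2) by (simp add: defect_def)
qed (use assms in \<open>auto simp: substochastic_def intro!: clip_nonneg\<close>)

text \<open>The loss beyond \<open>v * e\<close> is at most \<open>\<delta>\<close> in both cases: a
  dropped \<open>v\<close> is below \<open>\<delta>\<close> and multiplies \<open>g \<le> 1\<close>,
  a kept one loses \<open>\<delta> * (v * g')\<close>.\<close>

lemma clip_mult_ge:
  assumes "0 \<le> v" "v \<le> 1" "0 < \<delta>" "\<delta> \<le> 1" "g \<le> 1" "0 \<le> g'" "g' \<le> 1" "g - e \<le> g'" "0 \<le> e"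
  shows "v * g - v * e - \<delta> \<le> clip \<delta> v * g'"
proof (cases "v < \<delta>")
  case True
  have "v * g \<le> v * 1" using assms by (intro mult_left_mono) auto
  moreover have "0 \<le> v * e" using assms by simp
  ultimately show ?thesis using True by (simp add: clip_def)
next
  case False
  have "v * (g - e) \<le> v * g'" using assms by (intro mult_left_mono) auto
  moreover have "v * g' \<le> 1" using assms mult_mono[of v 1 g' 1] by simp
  then have "\<delta> * (v * g') \<le> \<delta>" using assms mult_left_mono[of "v * g'" 1 \<delta>] by simp
  ultimately show ?thesis using False by (simp add: clip_def algebra_simps)
qed

text \<open>Each step loses at most \<open>\<delta>\<close> per transition entry and once more for
  the absorption entry. Earlier losses are not amplified, since row sums are at most 1, so the error
  is linear in \<open>k\<close>.\<close>

lemma absorb_clip_ge: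
  assumes sub: "substochastic S P a" and "finite S" "0 < \<delta>" "\<delta> \<le> 1" "i \<in> S"
  shows "absorb S P a k i - real k * (real (card S + 1) * \<delta>)
    \<le> absorb S (\<lambda>i j. clip \<delta> (P i j)) (\<lambda>i. clip \<delta> (a i)) k i"
  using assms(5)
proof (induction k arbitrary: i)
  case (Suc k)
  note i = Suc.prems
  let ?c = "absorb S (\<lambda>i j. clip \<delta> (P i j)) (\<lambda>i. clip \<delta> (a i)) k"
  define e where "e = real k * (real (card S + 1) * \<delta>)"
  have e: "0 \<le> e" using assms by (simp add: e_def)
  have nn: "0 \<le> a i" "\<And>j. j \<in> S \<Longrightarrow> 0 \<le> P i j" "a i + (\<Sum>j\<in>S. P i j) \<le> 1"
    using sub i by (auto simp: substochastic_def)
  have le1: "P i j \<le> 1" if "j \<in> S" for j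
    using member_le_sum[OF that, of "P i"] nn assms(2) by auto
  have "0 \<le> (\<Sum>j\<in>S. P i j)" using nn by (intro sum_nonneg)
  then have "a i \<le> 1" using nn by simp
  have "(\<Sum>j\<in>S. P i j * absorb S P a k j - P i j * e - \<delta>) \<le> (\<Sum>j\<in>S. clip \<delta> (P i j) * ?c j)"
    using assms nn le1 e Suc.IH
    by (intro sum_mono clip_mult_ge absorb_le_1[OF sub] absorb_nonneg[OF substochastic_clip[OF sub]]
        absorb_le_1[OF substochastic_clip[OF sub]]) (auto simp: e_def)
  moreover have "a i - \<delta> \<le> clip \<delta> (a i)"
    using clip_mult_ge[of "a i" \<delta> 1 1 0] nn \<open>a i \<le> 1\<close> assms by simp
  moreover have "(\<Sum>j\<in>S. P i j * absorb S P a k j - P i j * e - \<delta>)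
      = (\<Sum>j\<in>S. P i j * absorb S P a k j) - (\<Sum>j\<in>S. P i j) * e - real (card S) * \<delta>"
    by (simp add: sum_subtractf sum_distrib_right)
  moreover have "(\<Sum>j\<in>S. P i j) * e \<le> e"
    using mult_right_mono[OF _ e, of "\<Sum>j\<in>S. P i j" 1] nn by simp
  ultimately show ?case by (simp add: e_def algebra_simps)
qed simp

text \<open>Clip the first chain at an additive cost linear in \<open>k\<close>, pass to the second
  clipped chain by \<open>absorption_prob_perturb\<close> at a multiplicative cost independent of
  \<open>k\<close>, and undo the clipping for free, since clipping only lowers entries.\<close>

lemma absorb_clip_transfer:
  assumes fin: "finite S" and t: "t \<in> S" and beta: "1 \<le> \<beta>" and delta: "0 < \<delta>" "\<delta> \<le> 1"
    and sub: "substochastic S P a" and sub': "substochastic S P' a'"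
    and P: "\<And>i j. i \<in> S \<Longrightarrow> j \<in> S \<Longrightarrow> mclose \<beta> (clip \<delta> (P i j)) (clip \<delta> (P' i j))"
    and a: "\<And>i. i \<in> S \<Longrightarrow> mclose \<beta> (clip \<delta> (a i)) (clip \<delta> (a' i))"
    and d: "\<And>i. i \<in> S \<Longrightarrow> mclose \<beta> (defect S (\<lambda>i j. clip \<delta> (P i j)) (\<lambda>i. clip \<delta> (a i)) i)
      (defect S (\<lambda>i j. clip \<delta> (P' i j)) (\<lambda>i. clip \<delta> (a' i)) i)"
    and g: "\<And>i. i \<in> S \<Longrightarrow> 0 \<le> g i" "\<And>i. i \<in> S \<Longrightarrow> a' i + (\<Sum>j\<in>S. P' i j * g j) \<le> g i"
  shows "absorb S P a k t - real k * (real (card S + 1) * \<delta>) \<le> \<beta> ^ 3 ^ card S * g t"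
proof -
  define Q where "Q = (\<lambda>i j. clip \<delta> (P i j))"
  define b where "b = (\<lambda>i. clip \<delta> (a i))"
  define Q' where "Q' = (\<lambda>i j. clip \<delta> (P' i j))"
  define b' where "b' = (\<lambda>i. clip \<delta> (a' i))"
  have Q: "substochastic S Q b" and Q': "substochastic S Q' b'"
    unfolding Q_def b_def Q'_def b'_def by (intro substochastic_clip sub sub' delta)+
  obtain h where h: "\<And>i. i \<in> S \<Longrightarrow> h i = b i + (\<Sum>j\<in>S. Q i j * h j)"
    "\<And>i k. i \<in> S \<Longrightarrow> absorb S Q b k i \<le> h i"
    using absorb_fixpoint[OF Q] by metis
  obtain h' where h': "\<And>i. i \<in> S \<Longrightarrow> h' i = b' i + (\<Sum>j\<in>S. Q' i j * h' j)"
    "\<And>i b. i \<in> S \<Longrightarrow> (\<And>k. absorb S Q' b' k i \<le> b) \<Longrightarrow> h' i \<le> b"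
    using absorb_fixpoint[OF Q'] by metis
  have "a' i \<ge> 0 \<and> (\<forall>j\<in>S. P' i j \<ge> 0)" if "i \<in> S" for i
    using sub' that by (auto simp: substochastic_def)
  then have "b' i + (\<Sum>j\<in>S. Q' i j * g j) \<le> a' i + (\<Sum>j\<in>S. P' i j * g j)" if "i \<in> S" for i
    unfolding b'_def Q'_def using that g(1) delta
    by (intro add_mono sum_mono mult_right_mono clip_le_self) auto
  then have gs: "b' i + (\<Sum>j\<in>S. Q' i j * g j) \<le> g i" if "i \<in> S" for i
    using g(2)[OF that] that by (meson order_trans)
  then have "h' t \<le> g t"
    by (intro h'(2)[OF t] absorb_le_supersolution[OF Q' t] g(1) gs)
  obtain n where n: "card S = Suc n" using fin t by (metis card_gt_0_iff empty_iff gr0_implies_Suc)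
  have "h t \<le> \<beta> ^ 3 ^ Suc n * h' t"
  proof (rule absorption_prob_perturb[where P = Q and P' = Q' and a = b and a' = b'
        and d = "defect S Q b" and d' = "defect S Q' b'", OF fin n t beta])
    show "0 < defect S Q b i \<and> mclose \<beta> (defect S Q b i) (defect S Q' b' i)" if "i \<in> S" for i
      using d[OF that] defect_clip(1)[OF sub that delta] delta by (simp add: Q_def b_def Q'_def b'_def)
    show "0 \<le> Q i j \<and> mclose \<beta> (Q i j) (Q' i j)" if "i \<in> S" "j \<in> S" for i j
      using P that Q by (auto simp: Q_def Q'_def substochastic_def)
    show "0 \<le> b i \<and> mclose \<beta> (b i) (b' i)" if "i \<in> S" for i
      using a that Q by (auto simp: b_def b'_def substochastic_def)
    show "(b i + defect S Q b i + (\<Sum>j\<in>S. Q i j)) * h i = b i + (\<Sum>j\<in>S. Q i j * h j)" if "i \<in> S" for i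
      using h(1)[OF that] by (simp add: defect_def)
    show "(b' i + defect S Q' b' i + (\<Sum>j\<in>S. Q' i j)) * h' i = b' i + (\<Sum>j\<in>S. Q' i j * h' j)"
      if "i \<in> S" for i
      using h'(1)[OF that] by (simp add: defect_def)
  qed
  also have "\<dots> \<le> \<beta> ^ 3 ^ Suc n * g t" using \<open>h' t \<le> g t\<close> beta by (intro mult_left_mono) auto
  finally have "h t \<le> \<beta> ^ 3 ^ card S * g t" by (simp add: n)
  moreover have "absorb S P a k t - real k * (real (card S + 1) * \<delta>) \<le> absorb S Q b k t"
    unfolding Q_def b_def by (rule absorb_clip_ge[OF sub fin delta t])
  ultimately show ?thesis using h(2)[OF t, of k] by linarith
qed

section \<open>Computations within a time bound\<close>

definition advance :: "'q \<times> move \<Rightarrow> nat \<Rightarrow> 'q \<times> nat" where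
  "advance r i = (fst r, move_head (snd r) i)"

text \<open>The tape is an arbitrary function and not a word, so that tapes which agree only on the
  visited cells can be compared.\<close>

definition coin_succ :: "('q, 'a) pfa2 \<Rightarrow> (nat \<Rightarrow> 'a tape_symbol) \<Rightarrow> bool \<Rightarrow> 'q \<times> nat \<Rightarrow> 'q \<times> nat" where
  "coin_succ M \<tau> b c = advance (coin_step M (fst c) (\<tau> (snd c)) b) (snd c)"

definition det_succ :: "('q, 'a) pfa2 \<Rightarrow> (nat \<Rightarrow> 'a tape_symbol) \<Rightarrow> 'q \<times> nat \<Rightarrow> 'q \<times> nat" where
  "det_succ M \<tau> c = advance (det_step M (fst c) (\<tau> (snd c))) (snd c)"

definition succs :: "('q, 'a) pfa2 \<Rightarrow> (nat \<Rightarrow> 'a tape_symbol) \<Rightarrow> 'q \<times> nat \<Rightarrow> ('q \<times> nat) set" where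
  "succs M \<tau> c = (if fst c \<in> coin_states M then {coin_succ M \<tau> True c, coin_succ M \<tau> False c}
    else if fst c \<in> det_states M then {det_succ M \<tau> c} else {})"

definition step_mean :: "('q, 'a) pfa2 \<Rightarrow> (nat \<Rightarrow> 'a tape_symbol) \<Rightarrow> ('q \<times> nat \<Rightarrow> real) \<Rightarrow> 'q \<times> nat \<Rightarrow> real" where
  "step_mean M \<tau> f c = (if fst c \<in> coin_states M
      then (f (coin_succ M \<tau> True c) + f (coin_succ M \<tau> False c)) / 2
    else if fst c \<in> det_states M then f (det_succ M \<tau> c) else 0)"

text \<open>\<open>run M \<tau> B u k c\<close> is the expectation of \<open>u\<close> at the first configuration in \<open>B\<close>, counting
  only computations from \<open>c\<close> that reach \<open>B\<close> within \<open>k\<close> steps; \<open>run_lim\<close> drops the time bound.\<close>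

primrec run :: "('q, 'a) pfa2 \<Rightarrow> (nat \<Rightarrow> 'a tape_symbol) \<Rightarrow> ('q \<times> nat) set \<Rightarrow> ('q \<times> nat \<Rightarrow> real)
    \<Rightarrow> nat \<Rightarrow> 'q \<times> nat \<Rightarrow> real" where
  "run M \<tau> B u 0 c = (if c \<in> B then u c else 0)"
| "run M \<tau> B u (Suc k) c = (if c \<in> B then u c else step_mean M \<tau> (run M \<tau> B u k) c)"

definition run_lim :: "('q, 'a) pfa2 \<Rightarrow> (nat \<Rightarrow> 'a tape_symbol) \<Rightarrow> ('q \<times> nat) set \<Rightarrow> ('q \<times> nat \<Rightarrow> real)
    \<Rightarrow> 'q \<times> nat \<Rightarrow> real" where
  "run_lim M \<tau> B u c = (SUP k. run M \<tau> B u k c)"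

section \<open>Monotonicity, limits and locality of runs\<close>

lemma step_mean_mono:
  assumes "\<And>c'. c' \<in> succs M \<tau> c \<Longrightarrow> f c' \<le> g c'"
  shows "step_mean M \<tau> f c \<le> step_mean M \<tau> g c"
  using assms[of "coin_succ M \<tau> True c"] assms[of "coin_succ M \<tau> False c"] assms[of "det_succ M \<tau> c"]
  by (cases "fst c \<in> coin_states M") (simp_all add: step_mean_def succs_def)

lemma step_mean_cong:
  assumes "\<And>c'. c' \<in> succs M \<tau> c \<Longrightarrow> f c' = g c'"
  shows "step_mean M \<tau> f c = step_mean M \<tau> g c"
  using assms[of "coin_succ M \<tau> True c"] assms[of "coin_succ M \<tau> False c"] assms[of "det_succ M \<tau> c"]
  by (cases "fst c \<in> coin_states M") (simp_all add: step_mean_def succs_def)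

lemma step_mean_nonneg:
  assumes "\<And>c'. c' \<in> succs M \<tau> c \<Longrightarrow> 0 \<le> f c'"
  shows "0 \<le> step_mean M \<tau> f c"
  using step_mean_mono[of M \<tau> c "\<lambda>_. 0" f, OF assms] by (simp add: step_mean_def split: if_splits)

lemma step_mean_le:
  assumes "\<And>c'. c' \<in> succs M \<tau> c \<Longrightarrow> f c' \<le> b" "0 \<le> b"
  shows "step_mean M \<tau> f c \<le> b"
  using step_mean_mono[of M \<tau> c f "\<lambda>_. b", OF assms(1)] assms(2) by (simp add: step_mean_def split: if_splits)

lemma step_mean_add: "step_mean M \<tau> (\<lambda>c. f c + g c) c = step_mean M \<tau> f c + step_mean M \<tau> g c"
  by (simp add: step_mean_def add_divide_distrib)

lemma step_mean_sum:
  "step_mean M \<tau> (\<lambda>c. \<Sum>j\<in>J. v j * f j c) c = (\<Sum>j\<in>J. v j * step_mean M \<tau> (f j) c)"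
  by (simp add: step_mean_def sum.distrib[symmetric] sum_divide_distrib algebra_simps)

lemma step_mean_tendsto:
  assumes "\<And>c'. c' \<in> succs M \<tau> c \<Longrightarrow> (\<lambda>k. f k c') \<longlonglongrightarrow> g c'"
  shows "(\<lambda>k. step_mean M \<tau> (f k) c) \<longlonglongrightarrow> step_mean M \<tau> g c"
  using assms[of "coin_succ M \<tau> True c"] assms[of "coin_succ M \<tau> False c"] assms[of "det_succ M \<tau> c"]
  by (cases "fst c \<in> coin_states M") (auto simp: step_mean_def succs_def intro!: tendsto_intros)

lemma run_stop [simp]: "c \<in> B \<Longrightarrow> run M \<tau> B u k c = u c"
  by (cases k) auto

lemma run_nonneg:
  assumes "\<And>c. c \<in> B \<Longrightarrow> 0 \<le> u c"
  shows "0 \<le> run M \<tau> B u k c"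
  by (induction k arbitrary: c) (auto simp: assms intro!: step_mean_nonneg)

lemma run_le_1:
  assumes "\<And>c. c \<in> B \<Longrightarrow> u c \<le> 1"
  shows "run M \<tau> B u k c \<le> 1"
  by (induction k arbitrary: c) (auto simp: assms intro!: step_mean_le)

lemma run_mono_Suc:
  assumes "\<And>c. c \<in> B \<Longrightarrow> 0 \<le> u c"
  shows "run M \<tau> B u k c \<le> run M \<tau> B u (Suc k) c"
proof (induction k arbitrary: c)
  case 0
  then show ?case using assms by (auto intro: step_mean_nonneg)
next
  case (Suc k)
  then have "step_mean M \<tau> (run M \<tau> B u k) c \<le> step_mean M \<tau> (run M \<tau> B u (Suc k)) c"
    by (intro step_mean_mono)
  then show ?case by (simp del: run.simps(2) add: run.simps(2)[of M \<tau> B u k] run.simps(2)[of M \<tau> B u "Suc k"])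
qed

lemma run_mono:
  assumes "\<And>c. c \<in> B \<Longrightarrow> 0 \<le> u c" "k \<le> l"
  shows "run M \<tau> B u k c \<le> run M \<tau> B u l c"
  using lift_Suc_mono_le[of "\<lambda>k. run M \<tau> B u k c", OF run_mono_Suc[OF assms(1)] assms(2)] .

lemma run_lim:
  assumes "\<And>c. c \<in> B \<Longrightarrow> 0 \<le> u c \<and> u c \<le> 1"
  shows "(\<lambda>k. run M \<tau> B u k c) \<longlonglongrightarrow> run_lim M \<tau> B u c"
    and "run M \<tau> B u k c \<le> run_lim M \<tau> B u c"
    and "run_lim M \<tau> B u c \<le> 1"
    and "0 \<le> run_lim M \<tau> B u c"
proof -
  have le1: "run M \<tau> B u k c \<le> 1" and nonneg: "0 \<le> run M \<tau> B u k c" for k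
    by (rule run_le_1 run_nonneg; use assms in blast)+
  then have bdd: "bdd_above (range (\<lambda>k. run M \<tau> B u k c))"
    by (intro bdd_aboveI[of _ 1]) auto
  show lim: "(\<lambda>k. run M \<tau> B u k c) \<longlonglongrightarrow> run_lim M \<tau> B u c"
    unfolding run_lim_def using bdd
    by (intro LIMSEQ_incseq_SUP incseq_SucI run_mono_Suc) (use assms in blast)+
  show le: "run M \<tau> B u k c \<le> run_lim M \<tau> B u c" for k
    unfolding run_lim_def using bdd by (intro cSUP_upper) auto
  show "run_lim M \<tau> B u c \<le> 1"
    unfolding run_lim_def using le1 by (intro cSUP_least) auto
  show "0 \<le> run_lim M \<tau> B u c" using le[of 0] nonneg[of 0] by simp
qed

lemma run_lim_step:
  assumes "\<And>c. c \<in> B \<Longrightarrow> 0 \<le> u c \<and> u c \<le> 1" "c \<notin> B"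
  shows "run_lim M \<tau> B u c = step_mean M \<tau> (run_lim M \<tau> B u) c"
proof (rule LIMSEQ_unique)
  show "(\<lambda>k. run M \<tau> B u (Suc k) c) \<longlonglongrightarrow> run_lim M \<tau> B u c"
    using run_lim(1)[OF assms(1)] by (rule LIMSEQ_Suc)
  show "(\<lambda>k. run M \<tau> B u (Suc k) c) \<longlonglongrightarrow> step_mean M \<tau> (run_lim M \<tau> B u) c"
    using assms(2) by (auto intro!: step_mean_tendsto run_lim(1)[OF assms(1)])
qed

text \<open>\<open>I\<close> is invariant up to stopping, so only symbols and stop values met inside
  \<open>I\<close> matter. This serves both to exchange the tape beyond a block and to rewrite stop
  values.\<close>

lemma run_cong:
  assumes "c \<in> I"
    and "\<And>c. c \<in> I \<Longrightarrow> c \<notin> B \<Longrightarrow> \<tau> (snd c) = \<tau>' (snd c) \<and> succs M \<tau> c \<subseteq> I"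
    and "\<And>c. c \<in> I \<Longrightarrow> (c \<in> B \<longleftrightarrow> c \<in> B') \<and> (c \<in> B \<longrightarrow> u c = u' c)"
  shows "run M \<tau> B u k c = run M \<tau>' B' u' k c"
  using assms(1)
proof (induction k arbitrary: c)
  case 0
  then show ?case using assms(3) by auto
next
  case (Suc k)
  show ?case
  proof (cases "c \<in> B")
    case False
    then have "step_mean M \<tau> (run M \<tau> B u k) c = step_mean M \<tau> (run M \<tau>' B' u' k) c"
      using Suc assms(2)[OF Suc.prems False] by (intro step_mean_cong) auto
    also have "\<dots> = step_mean M \<tau>' (run M \<tau>' B' u' k) c"
      using assms(2)[OF Suc.prems False] by (simp add: step_mean_def coin_succ_def det_succ_def)
    finally show ?thesis using assms(3)[OF Suc.prems] False by simp
  qed (use assms(3)[OF Suc.prems] in auto)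
qed

text \<open>Finite, step-bounded counterpart of \<open>branches_to\<close>, linking sums over coin
  sequences with \<open>run\<close>.\<close>

primrec words_to :: "('q, 'a) pfa2 \<Rightarrow> (nat \<Rightarrow> 'a tape_symbol) \<Rightarrow> 'q \<Rightarrow> nat \<Rightarrow> 'q \<times> nat \<Rightarrow> bool list set" where
  "words_to M \<tau> f 0 c = (if fst c = f then {[]} else {})"
| "words_to M \<tau> f (Suc k) c = (if fst c = f then {[]}
    else if fst c \<in> coin_states M then (\<Union>b. (#) b ` words_to M \<tau> f k (coin_succ M \<tau> b c))
    else if fst c \<in> det_states M then words_to M \<tau> f k (det_succ M \<tau> c) else {})"

abbreviation hit :: "('q, 'a) pfa2 \<Rightarrow> (nat \<Rightarrow> 'a tape_symbol) \<Rightarrow> 'q \<Rightarrow> nat \<Rightarrow> 'q \<times> nat \<Rightarrow> real" where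
  "hit M \<tau> f \<equiv> run M \<tau> {c. fst c = f} (\<lambda>_. 1)"

lemma finite_words_to: "finite (words_to M \<tau> f k c)"
  by (induction k arbitrary: c) auto

text \<open>Sequences with different first outcomes are disjoint, and the first toss halves their
  weights; this is the averaging in \<open>step_mean\<close>.\<close>

lemma sum_words_to: "(\<Sum>w\<in>words_to M \<tau> f k c. (1 / 2) ^ length w) = hit M \<tau> f k c"
proof (induction k arbitrary: c)
  case (Suc k)
  have "(\<Sum>w\<in>(\<Union>b. (#) b ` words_to M \<tau> f k (coin_succ M \<tau> b c)). (1 / 2) ^ length w)
      = (\<Sum>b\<in>UNIV. \<Sum>w\<in>(#) b ` words_to M \<tau> f k (coin_succ M \<tau> b c). (1 / 2 :: real) ^ length w)"
    by (rule sum.UNION_disjoint) (auto simp: finite_words_to)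
  also have "\<dots> = (\<Sum>b\<in>UNIV. hit M \<tau> f k (coin_succ M \<tau> b c) / 2)"
    by (simp add: sum.reindex Suc.IH[symmetric] sum_divide_distrib)
  finally show ?case by (auto simp: Suc.IH step_mean_def UNIV_bool)
qed simp

lemma words_to_mono: "k \<le> l \<Longrightarrow> words_to M \<tau> f k c \<subseteq> words_to M \<tau> f l c"
proof (rule lift_Suc_mono_le[of "\<lambda>k. words_to M \<tau> f k c"])
  show "words_to M \<tau> f k c \<subseteq> words_to M \<tau> f (Suc k) c" for k
  proof (induction k arbitrary: c)
    case (Suc k)
    then have "(#) b ` words_to M \<tau> f k c' \<subseteq> (#) b ` words_to M \<tau> f (Suc k) c'" for b c'
      by (rule image_mono)
    then have "(\<Union>b. (#) b ` words_to M \<tau> f k (coin_succ M \<tau> b c))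
        \<subseteq> (\<Union>b. (#) b ` words_to M \<tau> f (Suc k) (coin_succ M \<tau> b c))" by (intro UN_mono) auto
    with Suc show ?case
      unfolding words_to.simps(2)[of M \<tau> f "Suc k" c] words_to.simps(2)[of M \<tau> f k c] by simp
  qed simp
qed

lemma words_to_monoD: "w \<in> words_to M \<tau> f k c \<Longrightarrow> k \<le> l \<Longrightarrow> w \<in> words_to M \<tau> f l c"
  by (rule subsetD[OF words_to_mono])

context pfa2
begin

text \<open>Deterministic steps toss no coins, so prepending them costs time only. The set
  \<open>V\<close> later confines the relation to finitely many configurations.\<close>

lemma words_to_det_relpow:
  assumes "(c, c') \<in> {(c, det_succ M \<tau> c) |c. fst c \<in> det_states M \<and> c \<in> V} ^^ t"
    and "f \<in> {accept M, reject M}" "w \<in> words_to M \<tau> f k c'"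
  shows "w \<in> words_to M \<tau> f (t + k) c"
  using assms(1,3)
proof (induction t arbitrary: c)
  case (Suc t)
  from relpow_Suc_D2[OF Suc.prems(1)] obtain c1 where
    c1: "(c, c1) \<in> {(c, det_succ M \<tau> c) |c. fst c \<in> det_states M \<and> c \<in> V}"
      "(c1, c') \<in> {(c, det_succ M \<tau> c) |c. fst c \<in> det_states M \<and> c \<in> V} ^^ t" by blast
  then show ?case
    using Suc.IH[OF c1(2) Suc.prems(2)] assms(2) accept_halts reject_halts coin_det_disjoint by auto
qed simp

section \<open>Finitely many configurations, and the time between coin tosses\<close>

definition configs :: "'a list \<Rightarrow> ('q \<times> nat) set" where
  "configs x = states M \<times> {..length x + 1}"

lemma finite_configs: "finite (configs x)" and card_configs: "card (configs x) = card (states M) * (length x + 2)"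
  by (simp_all add: configs_def finite_states card_cartesian_product)

lemma tape_in_symbols: "x \<in> lists (alphabet M) \<Longrightarrow> tape x i \<in> tape_symbols M"
  by (auto simp: tape_def tape_symbols_def in_lists_conv_set)

lemma tape_eq_Right_End: "tape x i = Right_End \<longleftrightarrow> length x < i"
  by (auto simp: tape_def)

lemma succs_cases:
  assumes "c' \<in> succs M \<tau> c" "\<tau> (snd c) \<in> tape_symbols M"
  obtains q d where "q \<in> states M" "legal_move (\<tau> (snd c)) d" "c' = (q, move_head d (snd c))"
proof -
  from assms(1) consider
    b where "fst c \<in> coin_states M" "c' = advance (coin_step M (fst c) (\<tau> (snd c)) b) (snd c)"
    | "fst c \<in> det_states M" "c' = advance (det_step M (fst c) (\<tau> (snd c))) (snd c)"
    by (auto simp: succs_def coin_succ_def det_succ_def split: if_splits)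
  then show ?thesis
  proof cases
    case 1
    then show ?thesis using coin_step_closed[OF 1(1) assms(2), of b] that
      by (cases "coin_step M (fst c) (\<tau> (snd c)) b") (auto simp: advance_def)
  next
    case 2
    then show ?thesis using det_step_closed[OF 2(1) assms(2)] that
      by (cases "det_step M (fst c) (\<tau> (snd c))") (auto simp: advance_def)
  qed
qed

lemma succs_configs:
  assumes "x \<in> lists (alphabet M)" "c \<in> configs x"
  shows "succs M (tape x) c \<subseteq> configs x"
proof
  fix c' assume "c' \<in> succs M (tape x) c"
  then obtain q d where qd: "q \<in> states M" "legal_move (tape x (snd c)) d" "c' = (q, move_head d (snd c))"
    using succs_cases tape_in_symbols[OF assms(1)] by metis
  then show "c' \<in> configs x"
    using assms(2) by (cases d) (auto simp: configs_def legal_move_def tape_eq_Right_End)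
qed

lemma reaches_words_to:
  assumes "reaches M x c w c'" "fst c' = f" "f \<in> {accept M, reject M}"
  shows "\<exists>k. w \<in> words_to M (tape x) f k c"
  using assms
proof (induction rule: reaches.induct)
  case (refl c)
  then show ?case by (auto intro: exI[of _ 0])
next
  case (det q i q' d w c)
  then obtain k where "w \<in> words_to M (tape x) f k (q', move_head d i)" by auto
  then have "w \<in> words_to M (tape x) f (Suc k) (q, i)"
    using det accept_halts reject_halts coin_det_disjoint by (auto simp: det_succ_def advance_def)
  then show ?case by blast
next
  case (coin q i b q' d w c)
  then obtain k where "w \<in> words_to M (tape x) f k (q', move_head d i)" by auto
  then have "b # w \<in> words_to M (tape x) f (Suc k) (q, i)"
    using coin accept_halts reject_halts by (auto simp: coin_succ_def advance_def intro!: exI[of _ b])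
  then show ?case by blast
qed

definition det_rel :: "'a list \<Rightarrow> (('q \<times> nat) \<times> ('q \<times> nat)) set" where
  "det_rel x = {(c, det_succ M (tape x) c) |c. fst c \<in> det_states M \<and> c \<in> configs x}"

lemma card_det_rel: "finite (det_rel x)" "card (det_rel x) \<le> card (configs x)"
proof -
  have sub: "det_rel x \<subseteq> (\<lambda>c. (c, det_succ M (tape x) c)) ` configs x" by (auto simp: det_rel_def)
  then show "finite (det_rel x)" using finite_configs finite_subset by blast
  show "card (det_rel x) \<le> card (configs x)"
    using sub finite_configs by (rule surj_card_le[rotated])
qed

text \<open>Splits off the stretch before the first toss, so that a later induction can run over the
  coin sequence and shorten each stretch separately.\<close>

lemma reaches_decompose:
  assumes "reaches M x c w c'" "x \<in> lists (alphabet M)" "c \<in> configs x"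
  shows "case w of [] \<Rightarrow> (c, c') \<in> (det_rel x)\<^sup>*
    | b # v \<Rightarrow> \<exists>c1\<in>configs x. (c, c1) \<in> (det_rel x)\<^sup>* \<and> fst c1 \<in> coin_states M \<and>
        coin_succ M (tape x) b c1 \<in> configs x \<and> reaches M x (coin_succ M (tape x) b c1) v c'"
  using assms
proof (induction rule: reaches.induct)
  case (refl c)
  then show ?case by simp
next
  case (det q i q' d w c)
  have eq: "det_succ M (tape x) (q, i) = (q', move_head d i)"
    using det by (simp add: det_succ_def advance_def)
  then have "(q', move_head d i) \<in> succs M (tape x) (q, i)"
    using det coin_det_disjoint by (auto simp: succs_def)
  then have "(q', move_head d i) \<in> configs x" using succs_configs det.prems by blast
  moreover have "((q, i), (q', move_head d i)) \<in> det_rel x"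
    using det eq by (auto simp: det_rel_def)
  ultimately have IH: "case w of [] \<Rightarrow> ((q', move_head d i), c) \<in> (det_rel x)\<^sup>*
    | b # v \<Rightarrow> \<exists>c1\<in>configs x. ((q', move_head d i), c1) \<in> (det_rel x)\<^sup>* \<and> fst c1 \<in> coin_states M \<and>
        coin_succ M (tape x) b c1 \<in> configs x \<and> reaches M x (coin_succ M (tape x) b c1) v c"
    and trans: "\<And>c. ((q', move_head d i), c) \<in> (det_rel x)\<^sup>* \<Longrightarrow> ((q, i), c) \<in> (det_rel x)\<^sup>*"
    using det.IH[OF det.prems(1)] converse_rtrancl_into_rtrancl[of "(q, i)"] by simp_all
  show ?case
  proof (cases w)
    case Nil
    then show ?thesis using IH trans by simp
  next
    case (Cons b v)
    from IH[unfolded Cons list.case] obtain c1 where "c1 \<in> configs x"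
      "((q', move_head d i), c1) \<in> (det_rel x)\<^sup>*" "fst c1 \<in> coin_states M"
      "coin_succ M (tape x) b c1 \<in> configs x" "reaches M x (coin_succ M (tape x) b c1) v c" by (elim bexE conjE)
    then show ?thesis unfolding Cons list.case by (intro bexI[of _ c1] conjI trans)
  qed
next
  case (coin q i b q' d w c)
  have eq: "coin_succ M (tape x) b (q, i) = (q', move_head d i)"
    using coin by (simp add: coin_succ_def advance_def)
  then have "(q', move_head d i) \<in> succs M (tape x) (q, i)"
    using coin by (cases b) (auto simp: succs_def)
  then have "(q', move_head d i) \<in> configs x" using succs_configs coin.prems by blast
  then show ?case unfolding list.case using coin.hyps coin.prems eq by (intro bexI[of _ "(q, i)"]) simp_all
qed

text \<open>A shortest deterministic stretch between two coin tosses repeats no configuration.\<close>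

lemma reaches_in_time:
  assumes "reaches M x c w c'" "fst c' = f" "f \<in> {accept M, reject M}" "x \<in> lists (alphabet M)" "c \<in> configs x"
  shows "w \<in> words_to M (tape x) f ((length w + 1) * (card (configs x) + 1)) c"
proof -
  let ?N = "card (configs x)"
  have det: "w \<in> words_to M (tape x) f (?N + k) c"
    if "(c, c1) \<in> (det_rel x)\<^sup>*" "w \<in> words_to M (tape x) f k c1" for c c1 w k
  proof -
    \<comment> \<open>A path in a finite relation can be shortened to at most as many steps as the
      relation has pairs.\<close>
    from that(1) obtain t where t: "t \<le> card (det_rel x)" "(c, c1) \<in> det_rel x ^^ t"
      unfolding rtrancl_finite_eq_relpow[OF card_det_rel(1)] by blast
    have "w \<in> words_to M (tape x) f (t + k) c"
      using words_to_det_relpow[OF t(2)[unfolded det_rel_def] assms(3) that(2)] .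
    moreover have "t + k \<le> ?N + k" using t card_det_rel(2)[of x] by simp
    ultimately show ?thesis by (rule words_to_monoD)
  qed
  have coin: "b # v \<in> words_to M (tape x) f (Suc k) c"
    if "v \<in> words_to M (tape x) f k (coin_succ M (tape x) b c)" "fst c \<in> coin_states M" for b v k c
  proof -
    have "fst c \<noteq> f" using that(2) assms(3) accept_halts reject_halts by auto
    then show ?thesis using that unfolding words_to.simps by (simp add: image_iff)
  qed
  \<comment> \<open>The budget covers \<open>length w + 1\<close> deterministic stretches of at most
    \<open>?N\<close> steps each, one step per toss, and one spare step.\<close>
  show ?thesis using assms(1,5)
  proof (induction w arbitrary: c)
    case Nil
    have "(c, c') \<in> (det_rel x)\<^sup>*" using reaches_decompose[OF Nil(1) assms(4) Nil(2)] unfolding list.case .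
    moreover have "[] \<in> words_to M (tape x) f 1 c'" using assms(2) by simp
    ultimately have "[] \<in> words_to M (tape x) f (?N + 1) c" by (rule det)
    moreover have "?N + 1 = (length ([] :: bool list) + 1) * (?N + 1)" by simp
    ultimately show ?case by argo
  next
    case (Cons b v)
    obtain c1 where c1: "(c, c1) \<in> (det_rel x)\<^sup>*" "fst c1 \<in> coin_states M"
      "coin_succ M (tape x) b c1 \<in> configs x" "reaches M x (coin_succ M (tape x) b c1) v c'"
      using reaches_decompose[OF Cons.prems(1) assms(4) Cons.prems(2)] unfolding list.case by blast
    have "b # v \<in> words_to M (tape x) f (Suc ((length v + 1) * (?N + 1))) c1"
      using coin[OF Cons.IH[OF c1(4,3)] c1(2)] .
    from det[OF c1(1) this] have "b # v \<in> words_to M (tape x) f (?N + Suc ((length v + 1) * (?N + 1))) c" .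
    moreover have "?N + Suc ((length v + 1) * (?N + 1)) = (length (b # v) + 1) * (?N + 1)" by simp
    ultimately show ?case by argo
  qed
qed

section \<open>Branch sums and time-bounded probabilities\<close>

lemma branch_prob_eq: "branch_prob w = ennreal ((1 / 2) ^ length w)"
proof -
  have "1 / 2 = ennreal (1 / 2)" by (metis ennreal_1 ennreal_divide_numeral zero_le_one)
  then show ?thesis unfolding branch_prob_def by (metis ennreal_power zero_le_divide_1_iff zero_le_numeral)
qed

lemma sum_branch_prob: "(\<Sum>w\<in>F. branch_prob w) = ennreal (\<Sum>w\<in>F. (1 / 2) ^ length w)"
  by (simp add: branch_prob_eq sum_ennreal)

lemma infsum_ennreal_SUP: "infsum f A = (SUP F\<in>{F. finite F \<and> F \<subseteq> A}. sum f F)" for f :: "'b \<Rightarrow> ennreal"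
  by (rule nonneg_infsum_complete) simp

text \<open>By Markov's inequality, branches with more than \<open>m\<close> coin tosses have probability at most \<open>T / m\<close>.\<close>

lemma accept_in_time:
  assumes x: "x \<in> lists (alphabet M)" and \<gamma>: "ennreal \<gamma> \<le> accept_prob M x"
    and T: "expected_coin_tosses M x \<le> ennreal T" "0 \<le> T" and "0 < m"
    and K: "(m + 1) * (card (configs x) + 1) \<le> K"
  shows "\<gamma> - T / real m \<le> hit M (tape x) (accept M) K (start M, 0)"
proof -
  let ?A = "accepting_branches M x"
  let ?h = "hit M (tape x) (accept M) K (start M, 0)"
  have h: "0 \<le> ?h" by (rule run_nonneg) simp
  have s: "(start M, 0) \<in> configs x" using start_state by (simp add: configs_def)
  have "sum branch_prob F \<le> ennreal (?h + T / real m)" if F: "finite F" "F \<subseteq> ?A" for F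
  proof -
    have "(\<Sum>w\<in>F. of_nat (length w) * branch_prob w) \<le> expected_coin_tosses M x"
      unfolding expected_coin_tosses_def infsum_ennreal_SUP using F
      by (intro SUP_upper) (auto simp: halting_branches_def)
    also have "\<dots> \<le> ennreal T" by (rule T)
    finally have "ennreal (\<Sum>w\<in>F. real (length w) * (1 / 2) ^ length w) \<le> ennreal T"
      by (simp add: branch_prob_eq ennreal_of_nat_eq_real_of_nat ennreal_mult[symmetric] sum_ennreal)
    then have ET: "(\<Sum>w\<in>F. real (length w) * (1 / 2) ^ length w) \<le> T"
      using T(2) by (simp add: ennreal_le_iff)
    have short: "{w \<in> F. length w \<le> m} \<subseteq> words_to M (tape x) (accept M) K (start M, 0)"
    proof
      fix w assume "w \<in> {w \<in> F. length w \<le> m}"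
      then obtain i where i: "reaches M x (start M, 0) w (accept M, i)" and w: "length w \<le> m"
        using F by (auto simp: accepting_branches_def branches_to_def)
      have "(length w + 1) * (card (configs x) + 1) \<le> (m + 1) * (card (configs x) + 1)"
        using w by (intro mult_right_mono) auto
      with K have "(length w + 1) * (card (configs x) + 1) \<le> K" by linarith
      then show "w \<in> words_to M (tape x) (accept M) K (start M, 0)"
        by (intro words_to_monoD[OF reaches_in_time[OF i _ _ x s]]) simp_all
    qed
    \<comment> \<open>Markov's inequality termwise: \<open>1 \<le> length w / m\<close> whenever
      \<open>length w\<close> exceeds \<open>m\<close>.\<close>
    have "(\<Sum>w\<in>F. (1 / 2) ^ length w)
        \<le> (\<Sum>w\<in>F. (if length w \<le> m then (1 / 2) ^ length w else 0) + (real (length w) * (1 / 2) ^ length w) / real m)"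
      using \<open>0 < m\<close> by (intro sum_mono) (auto simp: field_simps)
    also have "\<dots> = (\<Sum>w\<in>{w \<in> F. length w \<le> m}. (1 / 2) ^ length w)
        + (\<Sum>w\<in>F. real (length w) * (1 / 2) ^ length w) / real m"
      using F by (simp add: sum.distrib sum_divide_distrib sum.inter_filter)
    also have "\<dots> \<le> ?h + T / real m"
      unfolding sum_words_to[symmetric] using short ET
      by (intro add_mono sum_mono2 divide_right_mono finite_words_to) auto
    finally show ?thesis unfolding sum_branch_prob by (rule ennreal_leI)
  qed
  then have "accept_prob M x \<le> ennreal (?h + T / real m)"
    unfolding accept_prob_def infsum_ennreal_SUP by (intro SUP_least) auto
  with \<gamma> have "ennreal \<gamma> \<le> ennreal (?h + T / real m)" by (rule order_trans)
  moreover have "0 \<le> ?h + T / real m" using h T by simp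
  ultimately show ?thesis by (simp add: ennreal_le_iff)
qed

lemma hit_accept_reject: "hit M \<tau> (accept M) k c + hit M \<tau> (reject M) k c \<le> 1"
proof (induction k arbitrary: c)
  case (Suc k)
  then have "step_mean M \<tau> (\<lambda>c. hit M \<tau> (accept M) k c + hit M \<tau> (reject M) k c) c \<le> 1"
    by (intro step_mean_le) auto
  then show ?case using accept_neq_reject accept_halts reject_halts
    by (auto simp: step_mean_add) (auto simp: step_mean_def)
qed (use accept_neq_reject in auto)

text \<open>A rejection probability above 1/2 is witnessed by finitely many branches, hence within a
  finite time; but within any common time bound, acceptance and rejection have total probability at
  most 1.\<close>

lemma reject_prob_less:
  assumes "1 / 2 \<le> hit M (tape x) (accept M) k (start M, 0)" "1 / 2 < \<gamma>"
  shows "reject_prob M x < ennreal \<gamma>"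
proof (rule ccontr)
  assume "\<not> ?thesis"
  then have "ennreal (1 / 2) < reject_prob M x"
    using assms(2) by (meson ennreal_lessI less_le_trans not_less order_less_trans zero_less_divide_1_iff zero_less_numeral)
  then obtain F where F: "finite F" "F \<subseteq> rejecting_branches M x" "ennreal (1 / 2) < sum branch_prob F"
    unfolding reject_prob_def infsum_ennreal_SUP by (auto simp: less_SUP_iff)
  have "\<exists>k. w \<in> words_to M (tape x) (reject M) k (start M, 0)" if "w \<in> F" for w
    using that F(2) reaches_words_to by (fastforce simp: rejecting_branches_def branches_to_def)
  then obtain l where l: "\<And>w. w \<in> F \<Longrightarrow> w \<in> words_to M (tape x) (reject M) (l w) (start M, 0)" by metis
  define K where "K = Max (insert k (l ` F))"
  have K: "k \<le> K" "\<And>w. w \<in> F \<Longrightarrow> l w \<le> K" using F(1) by (auto simp: K_def)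
  have "F \<subseteq> words_to M (tape x) (reject M) K (start M, 0)"
    using words_to_monoD[OF l K(2)] by blast
  then have "(\<Sum>w\<in>F. (1 / 2) ^ length w) \<le> hit M (tape x) (reject M) K (start M, 0)"
    unfolding sum_words_to[symmetric] by (intro sum_mono2 finite_words_to) auto
  moreover have "1 / 2 < (\<Sum>w\<in>F. (1 / 2 :: real) ^ length w)"
    using F(3)[unfolded sum_branch_prob] by (subst (asm) ennreal_less_iff) simp_all
  moreover have "1 / 2 \<le> hit M (tape x) (accept M) K (start M, 0)"
    using run_mono[OF _ K(1), of "{c. fst c = accept M}" "\<lambda>_. 1" M "tape x" "(start M, 0)"] assms(1) by simp
  ultimately show False using hit_accept_reject[of "tape x" K "(start M, 0)"] by simp
qed

end

section \<open>Cutting the input in two\<close>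

lemma run_linear:
  "run M \<tau> B (\<lambda>c. u c + (\<Sum>j\<in>J. v j * w j c)) k c
    = run M \<tau> B u k c + (\<Sum>j\<in>J. v j * run M \<tau> B (w j) k c)"
proof (induction k arbitrary: c)
  case (Suc k)
  show ?case
  proof (cases "c \<in> B")
    case False
    have "step_mean M \<tau> (run M \<tau> B (\<lambda>c. u c + (\<Sum>j\<in>J. v j * w j c)) k) c
        = step_mean M \<tau> (\<lambda>c. run M \<tau> B u k c + (\<Sum>j\<in>J. v j * run M \<tau> B (w j) k c)) c"
      by (intro step_mean_cong Suc.IH)
    also have "\<dots> = step_mean M \<tau> (run M \<tau> B u k) c + (\<Sum>j\<in>J. v j * step_mean M \<tau> (run M \<tau> B (w j) k) c)"
      by (simp add: step_mean_add step_mean_sum)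
    finally show ?thesis using False by simp
  qed simp
qed simp

section \<open>A single block: accepting inside it or leaving it\<close>

abbreviation hit_lim :: "('q, 'a) pfa2 \<Rightarrow> (nat \<Rightarrow> 'a tape_symbol) \<Rightarrow> 'q \<Rightarrow> 'q \<times> nat \<Rightarrow> real" where
  "hit_lim M \<tau> f \<equiv> run_lim M \<tau> {c. fst c = f} (\<lambda>_. 1)"

text \<open>Rejection inside \<open>D\<close> is not listed: the reject state has no successors, so
  \<open>step_mean\<close> is 0 there and it contributes nothing.\<close>

definition block_stop :: "('q, 'a) pfa2 \<Rightarrow> nat set \<Rightarrow> ('q \<times> nat) set" where
  "block_stop M D = {c. fst c = accept M \<or> snd c \<notin> D}"

definition exit_prob :: "('q, 'a) pfa2 \<Rightarrow> (nat \<Rightarrow> 'a tape_symbol) \<Rightarrow> nat set \<Rightarrow> 'q \<times> nat \<Rightarrow> 'q \<times> nat \<Rightarrow> real" where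
  "exit_prob M \<tau> D c e = run_lim M \<tau> (block_stop M D) (\<lambda>c. of_bool (c = e)) c"

text \<open>A stop inside \<open>D\<close> can only be an acceptance. Entering the accept state by
  the very step that leaves \<open>D\<close> counts as an exit; the next block then accepts at
  once.\<close>

definition inner_accept_prob :: "('q, 'a) pfa2 \<Rightarrow> (nat \<Rightarrow> 'a tape_symbol) \<Rightarrow> nat set \<Rightarrow> 'q \<times> nat \<Rightarrow> real" where
  "inner_accept_prob M \<tau> D c = run_lim M \<tau> (block_stop M D) (\<lambda>c. of_bool (snd c \<in> D)) c"

text \<open>A computation starting in \<open>D\<close> spends at least one step before it leaves, so
  at most \<open>m\<close> of \<open>Suc m\<close> steps remain at the exit; the disjunction carries
  this through the induction.\<close>

lemma hit_le_block:
  assumes "snd c \<in> D \<and> k \<le> Suc m \<or> k \<le> m"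
  shows "hit M \<tau> (accept M) k c
    \<le> run M \<tau> (block_stop M D) (\<lambda>c. if snd c \<in> D then 1 else hit M \<tau> (accept M) m c) k c"
    (is "_ \<le> run _ _ ?B ?u k c")
  using assms
proof (induction k arbitrary: c)
  case 0
  then show ?case by (auto simp: block_stop_def run_nonneg)
next
  case (Suc k)
  show ?case
  proof (cases "c \<in> ?B")
    case True
    show ?thesis
    proof (cases "snd c \<in> D")
      case True
      then show ?thesis using run_le_1[of "{c. fst c = accept M}" "\<lambda>_. 1" M \<tau> "Suc k" c] \<open>c \<in> ?B\<close> by simp
    next
      case False
      then have "hit M \<tau> (accept M) (Suc k) c \<le> hit M \<tau> (accept M) m c"
        using Suc.prems by (intro run_mono) auto
      then show ?thesis using False \<open>c \<in> ?B\<close> by simp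
    qed
  next
    case False
    then have "step_mean M \<tau> (hit M \<tau> (accept M) k) c \<le> step_mean M \<tau> (run M \<tau> ?B ?u k) c"
      using Suc.prems by (intro step_mean_mono Suc.IH) (auto simp: block_stop_def)
    then show ?thesis using False by (simp add: block_stop_def)
  qed
qed

text \<open>\<open>hit_lim\<close> satisfies the one-step equation off the stopping set, so stopping
  early with its value as reward cannot exceed it.\<close>

lemma block_le_hit_lim:
  "run M \<tau> (block_stop M D) (\<lambda>c. if snd c \<in> D then 1 else hit_lim M \<tau> (accept M) c) k c
    \<le> hit_lim M \<tau> (accept M) c"
    (is "run _ _ ?B ?u k c \<le> _")
proof (induction k arbitrary: c)
  have stop: "?u c \<le> hit_lim M \<tau> (accept M) c" if "c \<in> ?B" for c
    using that run_lim(2)[of "{c. fst c = accept M}" "\<lambda>_. 1" M \<tau> 0 c] by (auto simp: block_stop_def)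
  {
    case 0
    then show ?case using stop run_lim(4)[of "{c. fst c = accept M}" "\<lambda>_. 1" M \<tau> c] by simp
  next
    case (Suc k)
    show ?case
    proof (cases "c \<in> ?B")
      case False
      have "step_mean M \<tau> (run M \<tau> ?B ?u k) c \<le> step_mean M \<tau> (hit_lim M \<tau> (accept M)) c"
        by (intro step_mean_mono Suc.IH)
      also have "\<dots> = hit_lim M \<tau> (accept M) c"
        using False by (intro run_lim_step[symmetric]) (auto simp: block_stop_def)
      finally show ?thesis using False by simp
    qed (use stop in simp)
  }
qed

context pfa2
begin

text \<open>All exits land on the single cell \<open>p\<close>. On \<open>I\<close> the stop values
  are therefore a combination of the indicator of \<open>D\<close> and those of the exits
  \<open>(q, p)\<close>, and \<open>run\<close> is linear in them.\<close>

lemma block_decompose: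
  assumes c: "c \<in> I" and p: "p \<notin> D"
    and closed: "\<forall>c\<in>I. snd c \<in> D \<longrightarrow> succs M \<tau> c \<subseteq> I"
    and exits: "\<forall>c\<in>I. snd c \<notin> D \<longrightarrow> fst c \<in> states M \<and> snd c = p"
    and u: "\<forall>c. snd c \<in> D \<longrightarrow> u c = 1"
  shows "run M \<tau> (block_stop M D) u k c = run M \<tau> (block_stop M D) (\<lambda>c. of_bool (snd c \<in> D)) k c
    + (\<Sum>q\<in>states M. u (q, p) * run M \<tau> (block_stop M D) (\<lambda>c. of_bool (c = (q, p))) k c)"
proof -
  have "u c = of_bool (snd c \<in> D) + (\<Sum>q\<in>states M. u (q, p) * of_bool (c = (q, p)))"
    if cI: "c \<in> I" for c
  proof (cases "snd c \<in> D")
    case True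
    then have "(\<Sum>q\<in>states M. u (q, p) * of_bool (c = (q, p))) = 0"
      using p by (intro sum.neutral) auto
    moreover have "u c = 1" using u True by blast
    ultimately show ?thesis using True by simp
  next
    case False
    then obtain q where q: "c = (q, p)" "q \<in> states M" using exits cI by (cases c) auto
    have "(\<Sum>q'\<in>states M. u (q', p) * of_bool (c = (q', p))) = u (q, p) * of_bool (c = (q, p))"
      using finite_states q by (subst sum.remove[of _ q]) (auto intro!: sum.neutral)
    then show ?thesis using False q by simp
  qed
  then show ?thesis
    unfolding run_linear[symmetric]
    by (intro run_cong[OF c]) (use closed in \<open>auto simp: block_stop_def\<close>)
qed

text \<open>The time-bounded estimate serves the input whose acceptance is known; the one for limits
  makes \<open>hit_lim\<close> a supersolution for the input to which acceptance is
  transferred.\<close>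

lemma block_bounds:
  assumes c: "c \<in> I" "snd c \<in> D" and p: "p \<notin> D"
    and closed: "\<forall>c\<in>I. snd c \<in> D \<longrightarrow> succs M \<tau> c \<subseteq> I"
    and exits: "\<forall>c\<in>I. snd c \<notin> D \<longrightarrow> fst c \<in> states M \<and> snd c = p"
  shows "hit M \<tau> (accept M) (Suc m) c \<le> inner_accept_prob M \<tau> D c
      + (\<Sum>q\<in>states M. exit_prob M \<tau> D c (q, p) * hit M \<tau> (accept M) m (q, p))" (is ?upper)
    and "hit M \<tau> (accept M) 0 c \<le> inner_accept_prob M \<tau> D c" (is ?zero)
    and "inner_accept_prob M \<tau> D c + (\<Sum>q\<in>states M. exit_prob M \<tau> D c (q, p) * hit_lim M \<tau> (accept M) (q, p))
      \<le> hit_lim M \<tau> (accept M) c" (is ?lower)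
    and "inner_accept_prob M \<tau> D c + (\<Sum>q\<in>states M. exit_prob M \<tau> D c (q, p)) \<le> 1" (is ?row)
proof -
  let ?B = "block_stop M D"
  note decompose = block_decompose[OF c(1) p closed exits]
  have lim: "(\<lambda>k. run M \<tau> ?B u k c) \<longlonglongrightarrow> inner_accept_prob M \<tau> D c
      + (\<Sum>q\<in>states M. u (q, p) * exit_prob M \<tau> D c (q, p))"
    if u: "\<forall>c. snd c \<in> D \<longrightarrow> u c = 1" for u
    unfolding decompose[OF u] inner_accept_prob_def exit_prob_def
    by (intro tendsto_intros run_lim(1)) auto
  have le: "run M \<tau> ?B (\<lambda>c. of_bool (P c)) k c \<le> run_lim M \<tau> ?B (\<lambda>c. of_bool (P c)) c" for P k
    by (rule run_lim(2)) simp
  have "hit M \<tau> (accept M) (Suc m) c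
      \<le> run M \<tau> ?B (\<lambda>c. if snd c \<in> D then 1 else hit M \<tau> (accept M) m c) (Suc m) c"
    using c(2) by (intro hit_le_block) simp
  also have "\<dots> = run M \<tau> ?B (\<lambda>c. of_bool (snd c \<in> D)) (Suc m) c
      + (\<Sum>q\<in>states M. hit M \<tau> (accept M) m (q, p) * run M \<tau> ?B (\<lambda>c. of_bool (c = (q, p))) (Suc m) c)"
    using decompose[of "\<lambda>c. if snd c \<in> D then 1 else hit M \<tau> (accept M) m c" "Suc m"] p
    by (simp del: run.simps)
  also have "\<dots> \<le> inner_accept_prob M \<tau> D c
      + (\<Sum>q\<in>states M. hit M \<tau> (accept M) m (q, p) * exit_prob M \<tau> D c (q, p))"
    unfolding inner_accept_prob_def exit_prob_def
    by (intro add_mono sum_mono mult_left_mono le run_nonneg) simp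
  finally show ?upper by (simp add: mult.commute)
  have "hit M \<tau> (accept M) 0 c = run M \<tau> ?B (\<lambda>c. of_bool (snd c \<in> D)) 0 c"
    using c by (simp add: block_stop_def)
  then show ?zero using le[of "\<lambda>c. snd c \<in> D" 0] by (simp only: inner_accept_prob_def)
  let ?u = "\<lambda>c. if snd c \<in> D then 1 else hit_lim M \<tau> (accept M) c"
  have "inner_accept_prob M \<tau> D c + (\<Sum>q\<in>states M. ?u (q, p) * exit_prob M \<tau> D c (q, p))
      \<le> hit_lim M \<tau> (accept M) c"
    by (rule LIMSEQ_le_const2[OF lim]) (auto intro: block_le_hit_lim)
  then show ?lower using p by (simp add: mult.commute)
  \<comment> \<open>With all stop values equal to 1, the decomposition computes the probability of
    stopping at all.\<close>
  have "inner_accept_prob M \<tau> D c + (\<Sum>q\<in>states M. (\<lambda>_. 1) (q, p) * exit_prob M \<tau> D c (q, p)) \<le> 1"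
    by (rule LIMSEQ_le_const2[OF lim]) (auto intro: run_le_1)
  then show ?row by simp
qed

lemma block_prob_nonneg: "0 \<le> exit_prob M \<tau> D c e" "0 \<le> inner_accept_prob M \<tau> D c"
  unfolding exit_prob_def inner_accept_prob_def by (intro run_lim(4); simp)+

text \<open>The block together with the one cell beyond the boundary on which exits land; likewise
  for \<open>right_configs\<close>.\<close>

abbreviation left_configs :: "nat \<Rightarrow> ('q \<times> nat) set" where
  "left_configs n \<equiv> states M \<times> {..n + 1}"

abbreviation right_configs :: "nat \<Rightarrow> ('q \<times> nat) set" where
  "right_configs n \<equiv> states M \<times> {n..}"

lemma left_closed:
  assumes "\<tau> (snd c) \<in> tape_symbols M" "c \<in> left_configs n" "snd c \<in> {..n}"
  shows "succs M \<tau> c \<subseteq> left_configs n"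
proof
  fix c' assume "c' \<in> succs M \<tau> c"
  then obtain q d where qd: "q \<in> states M" "c' = (q, move_head d (snd c))"
    using succs_cases assms(1) by metis
  then show "c' \<in> left_configs n" using assms(3) by (cases d) auto
qed

lemma right_closed:
  assumes "\<tau> (snd c) \<in> tape_symbols M" "c \<in> right_configs n" "snd c \<in> {n<..}"
  shows "succs M \<tau> c \<subseteq> right_configs n"
proof
  fix c' assume "c' \<in> succs M \<tau> c"
  then obtain q d where qd: "q \<in> states M" "c' = (q, move_head d (snd c))"
    using succs_cases assms(1) by metis
  then show "c' \<in> right_configs n" using assms(3) by (cases d) auto
qed

text \<open>The two tapes can differ only from cell \<open>length x + 1\<close> on, which lies
  outside the block.\<close>

lemma left_block_eq:
  assumes "x \<in> lists (alphabet M)" "y \<in> lists (alphabet M)" "c \<in> left_configs (length x)"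
  shows "run M (tape (x @ y)) (block_stop M {..length x}) u k c = run M (tape x) (block_stop M {..length x}) u k c"
proof (rule run_cong[OF assms(3)])
  fix c assume c: "c \<in> left_configs (length x)" "c \<notin> block_stop M {..length x}"
  then have "snd c \<in> {..length x}" by (simp add: block_stop_def)
  moreover have "tape (x @ y) (snd c) \<in> tape_symbols M" using assms by (intro tape_in_symbols) auto
  ultimately show "tape (x @ y) (snd c) = tape x (snd c) \<and> succs M (tape (x @ y)) c \<subseteq> left_configs (length x)"
    using left_closed[OF _ c(1)] by (auto simp: tape_def nth_append)
qed simp

text \<open>A shift by \<open>length x\<close>: cell 0 of the tape of \<open>y\<close> stands for
  the last cell of the left part. It lies outside the block, so its symbol is never read and no move
  meets the truncation of \<open>0 - 1\<close>.\<close>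

lemma right_block_eq:
  "run M (tape (x @ y)) (block_stop M {length x<..}) u k (q, length x + i)
    = run M (tape y) (block_stop M {0<..}) (\<lambda>c. u (fst c, length x + snd c)) k (q, i)"
proof (induction k arbitrary: q i)
  case 0
  then show ?case by (simp add: block_stop_def)
next
  case (Suc k)
  show ?case
  proof (cases "(q, i) \<in> block_stop M {0<..}")
    case False
    then have i: "1 \<le> i" "q \<noteq> accept M" by (auto simp: block_stop_def)
    have tape: "tape (x @ y) (length x + i) = tape y i"
      using i by (auto simp: tape_def nth_append)
    have "move_head d (length x + i) = length x + move_head d i" for d
      using i by (cases d) auto
    then have "advance r (length x + i) = (fst (advance r i), length x + snd (advance r i))" for r :: "'q \<times> move"
      by (simp add: advance_def)
    then have "step_mean M (tape (x @ y)) (run M (tape (x @ y)) (block_stop M {length x<..}) u k) (q, length x + i)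
        = step_mean M (tape y) (run M (tape y) (block_stop M {0<..}) (\<lambda>c. u (fst c, length x + snd c)) k) (q, i)"
      by (simp add: step_mean_def coin_succ_def det_succ_def tape Suc.IH)
    then show ?thesis using False i by (simp add: block_stop_def)
  qed (auto simp: block_stop_def)
qed

text \<open>Computations on \<open>x @ y\<close> are cut at the boundary of \<open>x\<close> and \<open>y\<close>. In a state \<open>(q, b)\<close> of the
  resulting chain, \<open>b = 1\<close> and \<open>b = 2\<close> say that the head is on the cell to the left and to the right of
  this boundary, and \<open>b = 0\<close> that it is on the left end-marker, where the computation starts.\<close>

definition cut_config :: "'a list \<Rightarrow> 'q \<times> nat \<Rightarrow> 'q \<times> nat" where
  "cut_config x i = (fst i, if snd i = 0 then 0 else if snd i = 1 then length x else length x + 1)"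

definition cut_states :: "('q \<times> nat) set" where
  "cut_states = states M \<times> {0, 1, 2}"

text \<open>Left and right blocks alternate and \<open>b = 0\<close> is never re-entered. For empty
  \<open>x\<close>, \<open>b = 0\<close> and \<open>b = 1\<close> denote the same
  configuration.\<close>

definition cut_step :: "'a list \<Rightarrow> 'a list \<Rightarrow> 'q \<times> nat \<Rightarrow> 'q \<times> nat \<Rightarrow> real" where
  "cut_step x y i j = (if snd i < 2
    then if snd j = 2 then exit_prob M (tape x) {..length x} (cut_config x i) (fst j, length x + 1) else 0
    else if snd j = 1 then exit_prob M (tape y) {0<..} (fst i, 1) (fst j, 0) else 0)"

definition cut_accept :: "'a list \<Rightarrow> 'a list \<Rightarrow> 'q \<times> nat \<Rightarrow> real" where
  "cut_accept x y i = (if snd i < 2 then inner_accept_prob M (tape x) {..length x} (cut_config x i)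
    else inner_accept_prob M (tape y) {0<..} (fst i, 1))"

lemma sum_cut_states:
  "(\<Sum>j\<in>cut_states. f j) = (\<Sum>q\<in>states M. f (q, 0) + f (q, 1) + f (q, 2))" for f :: "'q \<times> nat \<Rightarrow> real"
  unfolding cut_states_def sum.cartesian_product' by (simp add: add.assoc)

lemma sum_cut_step:
  assumes "i \<in> cut_states"
  shows "(\<Sum>j\<in>cut_states. cut_step x y i j * f j) = (if snd i < 2
    then \<Sum>q\<in>states M. exit_prob M (tape x) {..length x} (cut_config x i) (q, length x + 1) * f (q, 2)
    else \<Sum>q\<in>states M. exit_prob M (tape y) {0<..} (fst i, 1) (q, 0) * f (q, 1))"
  by (simp add: sum_cut_states cut_step_def)

text \<open>These are \<open>block_bounds\<close> for the left and for the right block;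
  \<open>left_block_eq\<close> and \<open>right_block_eq\<close> make each row a function of its own
  half of the input.\<close>

lemma cut_bounds:
  assumes x: "x \<in> lists (alphabet M)" and y: "y \<in> lists (alphabet M)" and i: "i \<in> cut_states"
  defines "\<alpha> \<equiv> hit M (tape (x @ y)) (accept M)" and "h \<equiv> hit_lim M (tape (x @ y)) (accept M)"
  shows "\<alpha> (Suc m) (cut_config x i) \<le> cut_accept x y i + (\<Sum>j\<in>cut_states. cut_step x y i j * \<alpha> m (cut_config x j))"
    and "\<alpha> 0 (cut_config x i) \<le> cut_accept x y i"
    and "cut_accept x y i + (\<Sum>j\<in>cut_states. cut_step x y i j * h (cut_config x j)) \<le> h (cut_config x i)"
    and "cut_accept x y i + (\<Sum>j\<in>cut_states. cut_step x y i j) \<le> 1"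
proof -
  let ?\<tau> = "tape (x @ y)"
  have \<tau>: "?\<tau> j \<in> tape_symbols M" for j using x y by (intro tape_in_symbols) auto
  have row: "(\<Sum>j\<in>cut_states. cut_step x y i j) = (\<Sum>j\<in>cut_states. cut_step x y i j * 1)" by simp
  have "\<alpha> (Suc m) (cut_config x i) \<le> cut_accept x y i + (\<Sum>j\<in>cut_states. cut_step x y i j * \<alpha> m (cut_config x j)) \<and>
      \<alpha> 0 (cut_config x i) \<le> cut_accept x y i \<and>
      cut_accept x y i + (\<Sum>j\<in>cut_states. cut_step x y i j * h (cut_config x j)) \<le> h (cut_config x i) \<and>
      cut_accept x y i + (\<Sum>j\<in>cut_states. cut_step x y i j) \<le> 1"
  proof (cases "snd i < 2")
    case True
    let ?D = "{..length x}" and ?c = "cut_config x i" and ?p = "length x + 1"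
    have c: "?c \<in> left_configs (length x)" "snd ?c \<in> ?D"
      using i True by (auto simp: cut_config_def cut_states_def)
    have p: "?p \<notin> ?D" by simp
    have closed: "\<forall>c\<in>left_configs (length x). snd c \<in> ?D \<longrightarrow> succs M ?\<tau> c \<subseteq> left_configs (length x)"
      by (intro ballI impI left_closed[OF \<tau>])
    have exits: "\<forall>c\<in>left_configs (length x). snd c \<notin> ?D \<longrightarrow> fst c \<in> states M \<and> snd c = ?p"
      by auto
    have E: "exit_prob M (tape x) ?D ?c e = exit_prob M ?\<tau> ?D ?c e"
      and A: "cut_accept x y i = inner_accept_prob M ?\<tau> ?D ?c" for e
      using True by (simp_all add: exit_prob_def inner_accept_prob_def cut_accept_def run_lim_def left_block_eq[OF x y c(1)])
    have S: "(\<Sum>j\<in>cut_states. cut_step x y i j * f (cut_config x j))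
        = (\<Sum>q\<in>states M. exit_prob M ?\<tau> ?D ?c (q, ?p) * f (q, ?p))" for f
      using True unfolding sum_cut_step[OF i] E by (simp add: cut_config_def)
    note bounds = block_bounds[OF c p closed exits]
    show ?thesis
      using bounds(1)[of m] bounds(2-4)
      unfolding row S[of "\<alpha> m"] S[of h] S[of "\<lambda>_. 1"] A unfolding \<alpha>_def h_def mult_1_right by argo
  next
    case False
    let ?D = "{length x<..}" and ?c = "cut_config x i" and ?p = "length x"
    have i2: "snd i = 2" using False i by (auto simp: cut_states_def)
    have ceq: "?c = (fst i, length x + 1)" using i2 by (simp add: cut_config_def)
    have c: "?c \<in> right_configs (length x)" "snd ?c \<in> ?D"
      using i by (auto simp: ceq cut_states_def)
    have p: "?p \<notin> ?D" by simp
    have closed: "\<forall>c\<in>right_configs (length x). snd c \<in> ?D \<longrightarrow> succs M ?\<tau> c \<subseteq> right_configs (length x)"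
      by (intro ballI impI right_closed[OF \<tau>])
    have exits: "\<forall>c\<in>right_configs (length x). snd c \<notin> ?D \<longrightarrow> fst c \<in> states M \<and> snd c = ?p"
      by auto
    have R: "run M ?\<tau> (block_stop M ?D) u k ?c
        = run M (tape y) (block_stop M {0<..}) (\<lambda>c. u (fst c, length x + snd c)) k (fst i, 1)" for u k
      unfolding ceq by (rule right_block_eq)
    have E: "exit_prob M (tape y) {0<..} (fst i, 1) (q, 0) = exit_prob M ?\<tau> ?D ?c (q, ?p)" for q
    proof -
      have "(\<lambda>c :: 'q \<times> nat. of_bool ((fst c, length x + snd c) = (q, length x)) :: real) = (\<lambda>c. of_bool (c = (q, 0)))"
        by (auto simp: fun_eq_iff)
      then show ?thesis unfolding exit_prob_def run_lim_def R by simp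
    qed
    have A: "cut_accept x y i = inner_accept_prob M ?\<tau> ?D ?c"
      unfolding inner_accept_prob_def cut_accept_def run_lim_def R using False by simp
    have S: "(\<Sum>j\<in>cut_states. cut_step x y i j * f (cut_config x j))
        = (\<Sum>q\<in>states M. exit_prob M ?\<tau> ?D ?c (q, ?p) * f (q, ?p))" for f
      using False unfolding sum_cut_step[OF i] E by (simp add: cut_config_def)
    note bounds = block_bounds[OF c p closed exits]
    show ?thesis
      using bounds(1)[of m] bounds(2-4)
      unfolding row S[of "\<alpha> m"] S[of h] S[of "\<lambda>_. 1"] A unfolding \<alpha>_def h_def mult_1_right by argo
  qed
  then show "\<alpha> (Suc m) (cut_config x i) \<le> cut_accept x y i + (\<Sum>j\<in>cut_states. cut_step x y i j * \<alpha> m (cut_config x j))"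
    and "\<alpha> 0 (cut_config x i) \<le> cut_accept x y i"
    and "cut_accept x y i + (\<Sum>j\<in>cut_states. cut_step x y i j * h (cut_config x j)) \<le> h (cut_config x i)"
    and "cut_accept x y i + (\<Sum>j\<in>cut_states. cut_step x y i j) \<le> 1"
    by simp_all
qed

lemma cut_substochastic:
  assumes "x \<in> lists (alphabet M)" "y \<in> lists (alphabet M)"
  shows "substochastic cut_states (cut_step x y) (cut_accept x y)"
  unfolding substochastic_def using cut_bounds(4)[OF assms]
  by (auto simp: cut_step_def cut_accept_def block_prob_nonneg)

text \<open>One transition of the chain uses up at least one step of the automaton. The index is
  \<open>Suc k\<close> because \<open>absorb\<close> counts the final acceptance as a
  transition.\<close>

lemma hit_le_absorb:
  assumes "x \<in> lists (alphabet M)" "y \<in> lists (alphabet M)" "i \<in> cut_states"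
  shows "hit M (tape (x @ y)) (accept M) k (cut_config x i)
    \<le> absorb cut_states (cut_step x y) (cut_accept x y) (Suc k) i"
  using assms(3)
proof (induction k arbitrary: i)
  case 0
  then show ?case using cut_bounds(2)[OF assms(1,2)] by simp
next
  case (Suc k)
  have "(\<Sum>j\<in>cut_states. cut_step x y i j * hit M (tape (x @ y)) (accept M) k (cut_config x j))
      \<le> (\<Sum>j\<in>cut_states. cut_step x y i j * absorb cut_states (cut_step x y) (cut_accept x y) (Suc k) j)"
    using Suc cut_substochastic[OF assms(1,2)]
    by (intro sum_mono mult_left_mono Suc.IH) (auto simp: substochastic_def)
  then show ?case
    using cut_bounds(1)[OF assms(1,2) Suc.prems, of k]
    unfolding absorb.simps(2)[of _ _ _ "Suc k"] by linarith
qed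

end

section \<open>Counting classes\<close>

text \<open>\<open>Suc\<close> reserves level 0 for the value zero, which is not close to any
  positive value.\<close>

definition level :: "real \<Rightarrow> real \<Rightarrow> nat" where
  "level \<beta> v = (if v = 0 then 0 else Suc (nat \<lfloor>- log \<beta> v\<rfloor>))"

text \<open>Equal floors put the logarithms within distance 1. Since the values are at most 1, the
  floors are nonnegative and \<open>nat\<close> is injective on them.\<close>

lemma mclose_if_level_eq:
  assumes "1 < \<beta>" "0 \<le> u" "u \<le> 1" "0 \<le> v" "v \<le> 1" "level \<beta> u = level \<beta> v"
  shows "mclose \<beta> u v"
proof (cases "u = 0")
  case True
  then show ?thesis using assms by (auto simp: level_def mclose_def split: if_splits)
next
  case False
  with assms have pos: "0 < u" "0 < v" by (auto simp: level_def split: if_splits)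
  have "0 \<le> - log \<beta> u" "0 \<le> - log \<beta> v" using assms pos by (simp_all add: log_le_zero_cancel_iff)
  then have floors: "0 \<le> \<lfloor>- log \<beta> u\<rfloor>" "0 \<le> \<lfloor>- log \<beta> v\<rfloor>" unfolding zero_le_floor by auto
  have "nat \<lfloor>- log \<beta> u\<rfloor> = nat \<lfloor>- log \<beta> v\<rfloor>" using assms(6) pos unfolding level_def by auto
  then have "\<lfloor>- log \<beta> u\<rfloor> = \<lfloor>- log \<beta> v\<rfloor>" unfolding eq_nat_nat_iff[OF floors] .
  then have "log \<beta> u < log \<beta> v + 1" "log \<beta> v < log \<beta> u + 1" by linarith+
  moreover have "log \<beta> (\<beta> * w) = log \<beta> w + 1" if "0 < w" for w
    using assms(1) that by (simp add: log_mult)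
  ultimately have "log \<beta> u < log \<beta> (\<beta> * v)" "log \<beta> v < log \<beta> (\<beta> * u)" using pos by simp_all
  then show ?thesis using assms(1) pos by (simp add: mclose_def)
qed

lemma level_le:
  assumes "1 < \<beta>" "0 < r" "v = 0 \<or> r \<le> v"
  shows "level \<beta> v \<le> Suc (nat \<lfloor>log \<beta> (1 / r)\<rfloor>)"
proof (cases "v = 0")
  case False
  then have "log \<beta> r \<le> log \<beta> v" using assms by simp
  then have "- log \<beta> v \<le> log \<beta> (1 / r)" using assms by (simp add: log_divide)
  then show ?thesis using False by (auto simp: level_def intro!: nat_mono floor_mono)
qed (simp add: level_def)

text \<open>Supplies a nondecreasing bound, so that one value serves all lengths up to
  \<open>n\<close>; \<open>n + 2\<close> is the number of tape cells.\<close>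

lemma poly_bound:
  fixes p :: "real poly"
  obtains c d :: nat where "0 < c" "\<And>n. C * \<bar>poly p (real n)\<bar> \<le> real (c * (n + 2) ^ d)"
proof -
  define s where "s = \<bar>C\<bar> * (\<Sum>i\<le>degree p. \<bar>coeff p i\<bar>)"
  define c where "c = Suc (nat \<lceil>s\<rceil>)"
  have c: "s \<le> real c" unfolding c_def by linarith
  have "C * \<bar>poly p (real n)\<bar> \<le> real (c * (n + 2) ^ degree p)" for n
  proof -
    have "\<bar>poly p (real n)\<bar> \<le> (\<Sum>i\<le>degree p. \<bar>coeff p i * real n ^ i\<bar>)"
      unfolding poly_altdef by (rule sum_abs)
    also have "\<dots> \<le> (\<Sum>i\<le>degree p. \<bar>coeff p i\<bar> * (real n + 2) ^ degree p)"
    proof (intro sum_mono)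
      fix i assume "i \<in> {..degree p}"
      then have "real n ^ i \<le> (real n + 2) ^ i" "(real n + 2) ^ i \<le> (real n + 2) ^ degree p"
        by (auto intro: power_mono power_increasing)
      then have "real n ^ i \<le> (real n + 2) ^ degree p" by (rule order_trans)
      then show "\<bar>coeff p i * real n ^ i\<bar> \<le> \<bar>coeff p i\<bar> * (real n + 2) ^ degree p"
        by (auto simp: abs_mult intro!: mult_left_mono)
    qed
    also have "\<dots> = (\<Sum>i\<le>degree p. \<bar>coeff p i\<bar>) * (real n + 2) ^ degree p"
      by (simp add: sum_distrib_right)
    finally have "\<bar>C\<bar> * \<bar>poly p (real n)\<bar> \<le> \<bar>C\<bar> * ((\<Sum>i\<le>degree p. \<bar>coeff p i\<bar>) * (real n + 2) ^ degree p)"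
      by (rule mult_left_mono) simp
    also have "\<dots> = s * (real n + 2) ^ degree p" by (simp add: s_def)
    also have "\<dots> \<le> real c * (real n + 2) ^ degree p" using c by (intro mult_right_mono) auto
    finally have "\<bar>C\<bar> * \<bar>poly p (real n)\<bar> \<le> real (c * (n + 2) ^ degree p)" by (simp add: add.commute)
    moreover have "C * \<bar>poly p (real n)\<bar> \<le> \<bar>C\<bar> * \<bar>poly p (real n)\<bar>" by (intro mult_right_mono) auto
    ultimately show ?thesis by linarith
  qed
  then show ?thesis using that[of c "degree p"] by (simp add: c_def)
qed

lemma polylog_le_linear:
  fixes A B W :: real
  shows "\<forall>\<^sub>F n in sequentially. W * (A * ln (real n + 3) + B) ^ k \<le> real n"
proof -
  \<comment> \<open>With this exponent \<open>n\<close> is a product of \<open>Suc k\<close> factors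
    \<open>n powr a\<close>: \<open>k\<close> of them dominate the logarithms and the last one
    dominates \<open>W\<close>, also for \<open>k = 0\<close>.\<close>
  define a where "a = 1 / real (Suc k)"
  have a: "0 < a" by (simp add: a_def)
  have "((\<lambda>x. (A * ln (x + 3) + B) / x powr a) \<longlongrightarrow> 0) at_top"
    using a by real_asymp
  then have lim: "(\<lambda>n. (A * ln (real n + 3) + B) / real n powr a) \<longlonglongrightarrow> 0"
    by (rule filterlim_compose) (rule filterlim_real_sequentially)
  have "(\<lambda>n. W * (((A * ln (real n + 3) + B) / real n powr a) ^ k * real n powr - a)) \<longlonglongrightarrow> W * (0 ^ k * 0)"
    using a by (intro tendsto_intros lim) real_asymp
  then have "\<forall>\<^sub>F n in sequentially. W * (((A * ln (real n + 3) + B) / real n powr a) ^ k * real n powr - a) < 1"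
    by (rule order_tendstoD) simp
  with eventually_gt_at_top[of 0] show ?thesis
  proof eventually_elim
    case (elim n)
    have "(real n powr a) ^ k * real n powr a = (real n powr a) ^ Suc k" by simp
    also have "\<dots> = real n" using elim(1) by (subst powr_power) (simp_all add: a_def del: of_nat_Suc)
    finally have e: "(real n powr a) ^ k * real n powr a = real n" .
    have "W * (A * ln (real n + 3) + B) ^ k
        = W * (((A * ln (real n + 3) + B) / real n powr a) ^ k * real n powr - a) * ((real n powr a) ^ k * real n powr a)"
      using elim(1) by (simp add: power_divide powr_minus field_simps)
    also have "\<dots> \<le> 1 * real n" unfolding e using elim(2) by (intro mult_right_mono) auto
    finally show ?case by simp
  qed
qed

section \<open>Signatures of left parts and the choice of parameters\<close>

context pfa2
begin

lemma finite_cut_states: "finite cut_states"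
  by (simp add: cut_states_def finite_states)

text \<open>The rows of the chain in which the head is in the left part do not depend on the right part;
  therefore they can be recorded with the empty word as right part.\<close>

definition signature :: "real \<Rightarrow> real \<Rightarrow> 'a list \<Rightarrow>
    (('q \<times> nat) \<times> ('q \<times> nat) \<Rightarrow> nat) \<times> ('q \<times> nat \<Rightarrow> nat) \<times> ('q \<times> nat \<Rightarrow> nat)" where
  "signature \<beta> \<delta> x = (let P = (\<lambda>i j. clip \<delta> (cut_step x [] i j)); a = (\<lambda>i. clip \<delta> (cut_accept x [] i)) in
    (\<lambda>(i, j)\<in>cut_states \<times> cut_states. level \<beta> (P i j),
     \<lambda>i\<in>cut_states. level \<beta> (a i),
     \<lambda>i\<in>cut_states. level \<beta> (defect cut_states P a i)))"

lemma cut_left_rows: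
  assumes "snd i < 2"
  shows "cut_step x y i = cut_step x [] i" "cut_accept x y i = cut_accept x [] i"
  using assms by (auto simp: cut_step_def cut_accept_def fun_eq_iff)

lemma cut_right_rows:
  assumes "\<not> snd i < 2"
  shows "cut_step x y i = cut_step x' y i" "cut_accept x y i = cut_accept x' y i"
  using assms by (auto simp: cut_step_def cut_accept_def fun_eq_iff)

text \<open>A surviving entry is at least \<open>(1 - \<delta>) * \<delta>\<close>, hence at least
  \<open>\<delta> / 2\<close>; for the defects see \<open>defect_clip\<close>.\<close>

lemma cut_entry_bounds:
  assumes "x \<in> lists (alphabet M)" "y \<in> lists (alphabet M)" "0 < \<delta>" "\<delta> \<le> 1 / 2" "i \<in> cut_states"
  defines "P \<equiv> \<lambda>i j. clip \<delta> (cut_step x y i j)" and "a \<equiv> \<lambda>i. clip \<delta> (cut_accept x y i)"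
  shows "j \<in> cut_states \<Longrightarrow> (P i j = 0 \<or> \<delta> / 2 \<le> P i j) \<and> 0 \<le> P i j \<and> P i j \<le> 1"
    and "(a i = 0 \<or> \<delta> / 2 \<le> a i) \<and> 0 \<le> a i \<and> a i \<le> 1"
    and "\<delta> / 2 \<le> defect cut_states P a i \<and> defect cut_states P a i \<le> 1"
proof -
  note sub = cut_substochastic[OF assms(1,2)]
  have clip_ge: "clip \<delta> v = 0 \<or> \<delta> / 2 \<le> clip \<delta> v" for v
  proof (cases "v < \<delta>")
    case False
    then have "(1 / 2) * \<delta> \<le> (1 - \<delta>) * v" using assms(3,4) by (intro mult_mono) auto
    then show ?thesis using False by (simp add: clip_def)
  qed (simp add: clip_def)
  have sub': "substochastic cut_states P a"
    unfolding P_def a_def using assms by (intro substochastic_clip sub) auto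
  then have nn: "0 \<le> a i" "\<And>j. j \<in> cut_states \<Longrightarrow> 0 \<le> P i j" "a i + (\<Sum>j\<in>cut_states. P i j) \<le> 1"
    using assms(5) by (auto simp: substochastic_def)
  have "0 \<le> (\<Sum>j\<in>cut_states. P i j)" using nn by (intro sum_nonneg)
  then show "(a i = 0 \<or> \<delta> / 2 \<le> a i) \<and> 0 \<le> a i \<and> a i \<le> 1"
    using nn clip_ge unfolding a_def by fastforce
  show "(P i j = 0 \<or> \<delta> / 2 \<le> P i j) \<and> 0 \<le> P i j \<and> P i j \<le> 1" if "j \<in> cut_states"
    using member_le_sum[OF that nn(2) finite_cut_states] nn(1,3) nn(2)[OF that] clip_ge[of "cut_step x y i j"]
    unfolding P_def by fastforce
  show "\<delta> / 2 \<le> defect cut_states P a i \<and> defect cut_states P a i \<le> 1"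
    using defect_clip[OF sub assms(5,3)] assms(3,4) unfolding P_def a_def by fastforce
qed

lemma signature_range:
  assumes "x \<in> lists (alphabet M)" "1 < \<beta>" "0 < \<delta>" "\<delta> \<le> 1 / 2"
  defines "J \<equiv> {..Suc (nat \<lfloor>log \<beta> (2 / \<delta>)\<rfloor>)}"
  shows "signature \<beta> \<delta> x \<in> (cut_states \<times> cut_states \<rightarrow>\<^sub>E J) \<times> (cut_states \<rightarrow>\<^sub>E J) \<times> (cut_states \<rightarrow>\<^sub>E J)"
proof -
  have J: "level \<beta> v \<in> J" if "v = 0 \<or> \<delta> / 2 \<le> v" for v
    using level_le[of \<beta> "\<delta> / 2" v] assms(2,3) that by (simp add: J_def)
  have nil: "[] \<in> lists (alphabet M)" by simp
  let ?P = "\<lambda>i j. clip \<delta> (cut_step x [] i j)" and ?a = "\<lambda>i. clip \<delta> (cut_accept x [] i)"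
  note bounds = cut_entry_bounds[OF assms(1) nil assms(3,4)]
  have "level \<beta> (?P i j) \<in> J" if "i \<in> cut_states" "j \<in> cut_states" for i j
    using bounds(1)[OF that] J by blast
  moreover have "level \<beta> (?a i) \<in> J" if "i \<in> cut_states" for i using bounds(2)[OF that] J by blast
  moreover have "level \<beta> (defect cut_states ?P ?a i) \<in> J" if "i \<in> cut_states" for i
    using bounds(3)[OF that] J by blast
  ultimately show ?thesis
    unfolding signature_def Let_def mem_Times_iff fst_conv snd_conv
    by (intro conjI restrict_PiE_iff[THEN iffD2] ballI) auto
qed

lemma card_signature_range:
  fixes J :: "nat set"
  shows "card ((cut_states \<times> cut_states \<rightarrow>\<^sub>E J) \<times> (cut_states \<rightarrow>\<^sub>E J) \<times> (cut_states \<rightarrow>\<^sub>E J))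
    = card J ^ (card cut_states * card cut_states + card cut_states + card cut_states)"
  by (simp add: card_cartesian_product card_PiE finite_cut_states power_add)

text \<open>Collects all losses: \<open>T / m\<close> for cutting the time to \<open>K\<close>, the
  clipping error over \<open>Suc K\<close> transitions, and the factor for exchanging the left rows.
  The right rows are common to both inputs.\<close>

lemma accept_transfer:
  assumes x: "x \<in> lists (alphabet M)" and x': "x' \<in> lists (alphabet M)" and y: "y \<in> lists (alphabet M)"
    and sig: "signature \<beta> \<delta> x = signature \<beta> \<delta> x'"
    and params: "1 < \<beta>" "0 < \<delta>" "\<delta> \<le> 1 / 2"
    and \<gamma>: "ennreal \<gamma> \<le> accept_prob M (x @ y)"
    and T: "expected_coin_tosses M (x @ y) \<le> ennreal T" "0 \<le> T" and "0 < m"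
    and K: "(m + 1) * (card (configs (x @ y)) + 1) \<le> K"
  shows "\<gamma> - T / real m - real (Suc K) * (real (card cut_states + 1) * \<delta>)
    \<le> \<beta> ^ 3 ^ card cut_states * hit_lim M (tape (x' @ y)) (accept M) (start M, 0)"
proof -
  let ?s = "(start M, 0)"
  let ?Q = "\<lambda>x y i j. clip \<delta> (cut_step x y i j)" and ?b = "\<lambda>x y i. clip \<delta> (cut_accept x y i)"
  have s: "?s \<in> cut_states" using start_state by (simp add: cut_states_def)
  have cs: "cut_config x ?s = ?s" for x by (simp add: cut_config_def)
  have nil: "[] \<in> lists (alphabet M)" by simp
  have "level \<beta> (?Q x [] i j) = level \<beta> (?Q x' [] i j)" if "i \<in> cut_states" "j \<in> cut_states" for i j
    using sig that unfolding signature_def Let_def by (auto dest!: fun_cong[where x = "(i, j)"])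
  moreover have "level \<beta> (?b x [] i) = level \<beta> (?b x' [] i)" if "i \<in> cut_states" for i
    using sig that unfolding signature_def Let_def by (auto dest!: fun_cong[where x = i])
  moreover have "level \<beta> (defect cut_states (?Q x []) (?b x []) i) = level \<beta> (defect cut_states (?Q x' []) (?b x' []) i)"
    if "i \<in> cut_states" for i
    using sig that unfolding signature_def Let_def by (auto dest!: fun_cong[where x = i])
  moreover note b = cut_entry_bounds[OF x nil params(2,3)] and b' = cut_entry_bounds[OF x' nil params(2,3)]
  ultimately have close:
    "\<And>i j. i \<in> cut_states \<Longrightarrow> j \<in> cut_states \<Longrightarrow> mclose \<beta> (?Q x [] i j) (?Q x' [] i j)"
    "\<And>i. i \<in> cut_states \<Longrightarrow> mclose \<beta> (?b x [] i) (?b x' [] i)"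
    "\<And>i. i \<in> cut_states \<Longrightarrow> mclose \<beta> (defect cut_states (?Q x []) (?b x []) i) (defect cut_states (?Q x' []) (?b x' []) i)"
    using params(2) by (auto intro!: mclose_if_level_eq[OF params(1)] intro: order_trans[of 0 "\<delta> / 2"])
  have refl: "mclose \<beta> v v" if "0 \<le> v" for v
    using that params(1) mult_right_mono[of 1 \<beta> v] by (simp add: mclose_def)
  note b = cut_entry_bounds[OF x y params(2,3)]
  have defect_cong: "defect cut_states P a i = defect cut_states P' a' i" if "P i = P' i" "a i = a' i"
    for P P' :: "'q \<times> nat \<Rightarrow> 'q \<times> nat \<Rightarrow> real" and a a' i
    using that by (simp add: defect_def)
  have "absorb cut_states (cut_step x y) (cut_accept x y) (Suc K) ?s - real (Suc K) * (real (card cut_states + 1) * \<delta>)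
      \<le> \<beta> ^ 3 ^ card cut_states * hit_lim M (tape (x' @ y)) (accept M) (cut_config x' ?s)"
  proof (rule absorb_clip_transfer[OF finite_cut_states s])
    show "substochastic cut_states (cut_step x y) (cut_accept x y)"
      "substochastic cut_states (cut_step x' y) (cut_accept x' y)"
      by (intro cut_substochastic x x' y)+
    show "1 \<le> \<beta>" "0 < \<delta>" "\<delta> \<le> 1" using params by auto
    show "mclose \<beta> (?Q x y i j) (?Q x' y i j)" if "i \<in> cut_states" "j \<in> cut_states" for i j
    proof (cases "snd i < 2")
      case True
      show ?thesis using close(1)[OF that] unfolding cut_left_rows(1)[OF True, of _ y] .
    next
      case False
      then show ?thesis using b(1)[OF that] refl unfolding cut_right_rows(1)[OF False, of x' y x] by blast
    qed
    show "mclose \<beta> (?b x y i) (?b x' y i)" if "i \<in> cut_states" for i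
    proof (cases "snd i < 2")
      case True
      show ?thesis using close(2)[OF that] unfolding cut_left_rows(2)[OF True, of _ y] .
    next
      case False
      then show ?thesis using b(2)[OF that] refl unfolding cut_right_rows(2)[OF False, of x' y x] by blast
    qed
    show "mclose \<beta> (defect cut_states (?Q x y) (?b x y) i) (defect cut_states (?Q x' y) (?b x' y) i)"
      if "i \<in> cut_states" for i
    proof (cases "snd i < 2")
      case True
      have "defect cut_states (?Q x y) (?b x y) i = defect cut_states (?Q x []) (?b x []) i" for x
        by (rule defect_cong) (simp_all add: cut_left_rows[OF True, of _ y])
      then show ?thesis using close(3)[OF that] by simp
    next
      case False
      have "defect cut_states (?Q x' y) (?b x' y) i = defect cut_states (?Q x y) (?b x y) i"
        by (rule defect_cong) (simp_all add: cut_right_rows[OF False, of x' y x])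
      moreover have "0 \<le> defect cut_states (?Q x y) (?b x y) i"
        using b(3)[OF that] params(2) by linarith
      ultimately show ?thesis using refl by simp
    qed
    show "0 \<le> hit_lim M (tape (x' @ y)) (accept M) (cut_config x' i)" for i
      by (rule run_lim(4)) simp
    show "cut_accept x' y i + (\<Sum>j\<in>cut_states. cut_step x' y i j * hit_lim M (tape (x' @ y)) (accept M) (cut_config x' j))
        \<le> hit_lim M (tape (x' @ y)) (accept M) (cut_config x' i)" if "i \<in> cut_states" for i
      by (rule cut_bounds(3)[OF x' y that])
  qed
  moreover have "\<gamma> - T / real m \<le> hit M (tape (x @ y)) (accept M) K ?s"
    by (rule accept_in_time[OF _ \<gamma> T \<open>0 < m\<close> K]) (use x y in auto)
  moreover have "hit M (tape (x @ y)) (accept M) K ?s \<le> absorb cut_states (cut_step x y) (cut_accept x y) (Suc K) ?s"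
    using hit_le_absorb[OF x y s, of K] unfolding cs .
  ultimately show ?thesis unfolding cs by linarith
qed

lemma bounded_error_regular:
  fixes p :: "real poly"
  assumes tosses: "\<exists>C::real. \<forall>\<^sub>F n in sequentially. \<forall>x\<in>lists (alphabet M). length x = n \<longrightarrow>
      expected_coin_tosses M x \<le> ennreal (C * \<bar>poly p (real n)\<bar>)"
    and L: "recognizes_bounded_error M L"
  shows "regular (alphabet M) L"
proof -
  let ?\<Sigma> = "lists (alphabet M)" and ?s = "card cut_states" and ?q = "card (states M)"
  obtain \<gamma> :: real where \<gamma>: "1 / 2 < \<gamma>"
    and acc: "\<And>x. x \<in> ?\<Sigma> \<Longrightarrow> x \<in> L \<Longrightarrow> ennreal \<gamma> \<le> accept_prob M x"
    and rej: "\<And>x. x \<in> ?\<Sigma> \<Longrightarrow> x \<notin> L \<Longrightarrow> ennreal \<gamma> \<le> reject_prob M x"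
  proof -
    obtain \<epsilon> :: real where "\<epsilon> < 1 / 2" "\<forall>x\<in>?\<Sigma>. (x \<in> L \<longrightarrow> accept_prob M x \<ge> ennreal (1 - \<epsilon>)) \<and>
      (x \<notin> L \<longrightarrow> reject_prob M x \<ge> ennreal (1 - \<epsilon>))"
      using L unfolding recognizes_bounded_error_def by blast
    then show ?thesis by (intro that[of "1 - \<epsilon>"]) auto
  qed
  obtain C N0 where C: "\<And>n x. n \<ge> N0 \<Longrightarrow> x \<in> ?\<Sigma> \<Longrightarrow> length x = n \<Longrightarrow>
      expected_coin_tosses M x \<le> ennreal (C * \<bar>poly p (real n)\<bar>)"
    using tosses unfolding eventually_sequentially by blast
  obtain c d :: nat where c: "0 < c" "\<And>n. C * \<bar>poly p (real n)\<bar> \<le> real (c * (n + 2) ^ d)"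
    using poly_bound[of C p] by blast
  define T where "T n = c * (n + 2) ^ d" for n
  have T: "expected_coin_tosses M x \<le> ennreal (real (T n))"
    if "x \<in> ?\<Sigma>" "N0 \<le> length x" "length x \<le> n" for x n
  proof -
    have "C * \<bar>poly p (real (length x))\<bar> \<le> real (T (length x))" unfolding T_def by (rule c)
    moreover have "T (length x) \<le> T n"
      unfolding T_def using that(3) by (intro mult_left_mono power_mono) auto
    ultimately have "C * \<bar>poly p (real (length x))\<bar> \<le> real (T n)" by linarith
    then show ?thesis using C[OF that(2,1) HOL.refl] ennreal_leI order_trans by blast
  qed
  \<comment> \<open>Thus \<open>\<gamma> = 1 / 2 + 4 * \<eta>\<close>: two additive losses of
    \<open>\<eta>\<close> leave \<open>1 / 2 + 2 * \<eta>\<close>, still more than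
    \<open>(1 + 2 * \<eta>) / 2\<close>.\<close>
  define \<eta> where "\<eta> = (\<gamma> - 1 / 2) / 4"
  have \<eta>: "0 < \<eta>" using \<gamma> by (simp add: \<eta>_def)
  obtain r :: nat where r: "0 < r" "1 / real r \<le> \<eta>"
  proof -
    obtain k where "inverse (real (Suc k)) < \<eta>" using reals_Archimedean[OF \<eta>] by blast
    then show ?thesis by (intro that[of "Suc k"]) (simp_all add: inverse_eq_divide)
  qed
  \<comment> \<open>Makes the Markov loss \<open>T n / m n\<close> equal to \<open>1 / r\<close>,
    which is at most \<open>\<eta>\<close>.\<close>
  define m where "m n = r * T n" for n
  \<comment> \<open>Enough time for \<open>accept_in_time\<close>, since inputs of length at most
    \<open>n\<close> have at most \<open>?q * (n + 2)\<close> configurations.\<close>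
  define K where "K n = (m n + 1) * (?q * (n + 2) + 1)" for n
  \<comment> \<open>Makes the clipping error \<open>1 / (2 * r)\<close>; the factor 2 also ensures
    \<open>\<delta> n \<le> 1 / 2\<close>.\<close>
  define \<delta> where "\<delta> n = 1 / (2 * real r * real (Suc (K n)) * real (?s + 1))" for n
  define \<beta> where "\<beta> = root (3 ^ ?s) (1 + 2 * \<eta>)"
  have \<beta>: "1 < \<beta>" "\<beta> ^ 3 ^ ?s = 1 + 2 * \<eta>"
    using \<eta> by (simp_all add: \<beta>_def)
  have m: "0 < m n" for n using r c(1) by (simp add: m_def T_def)
  have \<delta>: "0 < \<delta> n" "\<delta> n \<le> 1 / 2" for n
  proof -
    have "1 * 1 * 1 \<le> real r * real (Suc (K n)) * real (?s + 1)"
      using r(1) by (intro mult_mono) auto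
    then show "0 < \<delta> n" "\<delta> n \<le> 1 / 2" by (auto simp: \<delta>_def field_simps)
  qed
  \<comment> \<open>The first component separates the words shorter than \<open>N0\<close> from all
    others, because the coin-toss bound is available only from length \<open>N0\<close> on.\<close>
  define \<kappa> where "\<kappa> n x = (if length x < N0 then Some x else None, signature \<beta> (\<delta> n) x)" for n x
  have sim: "x' @ v \<in> L"
    if x: "x \<in> ?\<Sigma>" and x': "x' \<in> ?\<Sigma>" and v: "v \<in> ?\<Sigma>" and \<kappa>: "\<kappa> n x = \<kappa> n x'"
      and len: "length (x @ v) \<le> n" "length (x' @ v) \<le> n" and xv: "x @ v \<in> L" for n x x' v
  proof (cases "x = x'")
    case False
    then have long: "N0 \<le> length x" "N0 \<le> length x'" using \<kappa> by (auto simp: \<kappa>_def split: if_splits)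
    have xv': "x @ v \<in> ?\<Sigma>" "x' @ v \<in> ?\<Sigma>" using x x' v by auto
    have "card (configs (x @ v)) \<le> ?q * (n + 2)"
      unfolding card_configs using len by (intro mult_left_mono) auto
    then have Kn: "(m n + 1) * (card (configs (x @ v)) + 1) \<le> K n"
      unfolding K_def by (intro mult_left_mono) auto
    have Tn: "expected_coin_tosses M (x @ v) \<le> ennreal (real (T n))"
      using T[OF xv'(1)] long len by auto
    have "\<gamma> - real (T n) / real (m n) - real (Suc (K n)) * (real (?s + 1) * \<delta> n)
      \<le> \<beta> ^ 3 ^ ?s * hit_lim M (tape (x' @ v)) (accept M) (start M, 0)"
      using \<kappa> by (intro accept_transfer[OF x x' v _ \<beta>(1) \<delta> acc[OF xv'(1) xv] Tn _ m Kn]) (auto simp: \<kappa>_def)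
    moreover have "real (T n) / real (m n) \<le> \<eta>"
      using r c(1) m[of n] by (simp add: m_def)
    moreover have "real (Suc (K n)) * (real (?s + 1) * \<delta> n) = 1 / (2 * real r)"
      by (simp add: \<delta>_def field_simps del: of_nat_Suc of_nat_add)
    moreover have "1 / (2 * real r) \<le> \<eta>" using r \<eta> by (simp add: field_simps)
    ultimately have ge: "\<gamma> - 2 * \<eta> \<le> (1 + 2 * \<eta>) * hit_lim M (tape (x' @ v)) (accept M) (start M, 0)"
      unfolding \<beta>(2) by linarith
    \<comment> \<open>By \<open>ge\<close> the limit exceeds 1/2, so 1/2 is reached in finite time,
      as \<open>reject_prob_less\<close> asks.\<close>
    have "\<exists>k. 1 / 2 \<le> hit M (tape (x' @ v)) (accept M) k (start M, 0)"
    proof (rule ccontr)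
      assume "\<not> ?thesis"
      then have "hit_lim M (tape (x' @ v)) (accept M) (start M, 0) \<le> 1 / 2"
        unfolding run_lim_def by (intro cSUP_least) (auto simp: not_le intro: less_imp_le)
      then have "(1 + 2 * \<eta>) * hit_lim M (tape (x' @ v)) (accept M) (start M, 0) \<le> (1 + 2 * \<eta>) * (1 / 2)"
        using \<eta> by (intro mult_left_mono) auto
      then show False using ge \<eta> by (simp add: \<eta>_def field_simps)
    qed
    then show ?thesis using reject_prob_less[OF _ \<gamma>] rej[OF xv'(2)] by (metis not_less)
  qed (use xv in simp)
  define J where "J n = nat \<lfloor>log \<beta> (2 / \<delta> n)\<rfloor> + 2" for n
  define D where "D = ?s * ?s + ?s + ?s"
  define W where "W = Suc (card {x. set x \<subseteq> alphabet M \<and> length x \<le> N0})"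
  define R where "R n = insert None (Some ` {x. set x \<subseteq> alphabet M \<and> length x \<le> N0}) \<times>
    ((cut_states \<times> cut_states \<rightarrow>\<^sub>E {..<J n}) \<times> (cut_states \<rightarrow>\<^sub>E {..<J n}) \<times> (cut_states \<rightarrow>\<^sub>E {..<J n}))" for n
  have fin_short: "finite {x. set x \<subseteq> alphabet M \<and> length x \<le> N0}"
    by (rule finite_lists_length_le[OF finite_alphabet])
  have finR: "finite (R n)" for n
    unfolding R_def using fin_short by (intro finite_cartesian_product finite_PiE finite_cut_states) auto
  have cardR: "card (R n) = W * J n ^ D" for n
    unfolding R_def card_cartesian_product[of "insert None _"] card_signature_range D_def W_def
    using fin_short by (simp add: card_image)
  have J_eq: "{..Suc (nat \<lfloor>log \<beta> (2 / \<delta> n)\<rfloor>)} = {..<J n}" for n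
    by (auto simp: J_def)
  have sub: "\<kappa> n ` ?\<Sigma> \<subseteq> R n" for n
    using signature_range[OF _ \<beta>(1) \<delta>, unfolded J_eq] by (fastforce simp: \<kappa>_def R_def)
  \<comment> \<open>\<open>K n\<close> is polynomially bounded in \<open>n\<close>, hence so is
    \<open>2 / \<delta> n\<close>, and its logarithm is \<open>O(ln n)\<close>.\<close>
  obtain A B :: real where AB: "\<And>n. real (J n) \<le> A * ln (real n + 2) + B" "0 \<le> A"
  proof -
    define c1 where "c1 = (r * c + 1) * (?q + 1) + 1"
    define c2 where "c2 = 4 * r * c1 * (?s + 1)"
    have Kle: "Suc (K n) \<le> c1 * (n + 2) ^ (d + 1)" for n
    proof -
      have "1 \<le> (n + 2) ^ d" "1 \<le> (n + 2) ^ (d + 1)" by (rule one_le_power, simp)+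
      then have "m n + 1 \<le> (r * c + 1) * (n + 2) ^ d" "?q * (n + 2) + 1 \<le> (?q + 1) * (n + 2)"
        by (simp_all add: m_def T_def algebra_simps)
      then have "K n \<le> ((r * c + 1) * (n + 2) ^ d) * ((?q + 1) * (n + 2))"
        unfolding K_def by (rule mult_mono) auto
      also have "\<dots> = (r * c + 1) * (?q + 1) * (n + 2) ^ (d + 1)" by (simp only: power_add power_one_right ac_simps)
      finally show ?thesis using \<open>1 \<le> (n + 2) ^ (d + 1)\<close> unfolding c1_def add_mult_distrib by linarith
    qed
    have c2: "0 < c2" using r(1) by (simp add: c2_def c1_def)
    have "real (J n) \<le> (real (d + 1) / ln \<beta>) * ln (real n + 2) + (\<bar>log \<beta> (real c2)\<bar> + 2)" for n
    proof -
      have "2 / \<delta> n = real (4 * r * Suc (K n) * (?s + 1))" by (simp add: \<delta>_def algebra_simps)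
      also have "\<dots> \<le> real (4 * r * (c1 * (n + 2) ^ (d + 1)) * (?s + 1))"
        by (intro of_nat_mono mult_right_mono mult_left_mono Kle) auto
      also have "\<dots> = real c2 * (real n + 2) ^ (d + 1)" by (simp add: c2_def algebra_simps)
      finally have "log \<beta> (2 / \<delta> n) \<le> log \<beta> (real c2 * (real n + 2) ^ (d + 1))"
        using \<beta>(1) \<delta>(1)[of n] c2 by (subst log_le_cancel_iff) auto
      also have "\<dots> = log \<beta> (real c2) + real (d + 1) * log \<beta> (real n + 2)"
        using \<beta>(1) c2 by (simp add: log_mult log_nat_power del: power_Suc)
      also have "real (d + 1) * log \<beta> (real n + 2) = real (d + 1) / ln \<beta> * ln (real n + 2)"
        by (simp add: log_def)
      finally have "log \<beta> (2 / \<delta> n) \<le> \<bar>log \<beta> (real c2)\<bar> + real (d + 1) / ln \<beta> * ln (real n + 2)"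
        by linarith
      moreover have "0 \<le> real (d + 1) / ln \<beta> * ln (real n + 2)"
        using \<beta>(1) by (intro mult_nonneg_nonneg divide_nonneg_nonneg) auto
      moreover have "real (nat \<lfloor>u\<rfloor>) \<le> w" if "u \<le> w" "0 \<le> w" for u w :: real using that by linarith
      ultimately have "real (nat \<lfloor>log \<beta> (2 / \<delta> n)\<rfloor>) \<le> \<bar>log \<beta> (real c2)\<bar> + real (d + 1) / ln \<beta> * ln (real n + 2)"
        by (meson abs_ge_zero add_nonneg_nonneg)
      then show ?thesis unfolding J_def by simp
    qed
    moreover have "0 \<le> real (d + 1) / ln \<beta>" using \<beta>(1) by simp
    ultimately show ?thesis by (rule that)
  qed
  have "\<forall>\<^sub>F n in sequentially. card (\<kappa> n ` ?\<Sigma>) * card (\<kappa> (Suc n) ` ?\<Sigma>) \<le> n"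
    using polylog_le_linear[of "real (W * W)" A B "D + D"]
  proof eventually_elim
    case (elim n)
    \<comment> \<open>\<open>ln (n + 3)\<close> serves both indices, as
      \<open>Suc n + 2 = n + 3\<close>.\<close>
    have le: "real (J n) \<le> A * ln (real n + 3) + B" "real (J (Suc n)) \<le> A * ln (real n + 3) + B"
      using AB(1)[of n] AB(1)[of "Suc n"] mult_left_mono[OF _ AB(2), of "ln (real n + 2)" "ln (real n + 3)"]
      by (auto simp: add.commute)
    have "card (\<kappa> n ` ?\<Sigma>) * card (\<kappa> (Suc n) ` ?\<Sigma>) \<le> (W * J n ^ D) * (W * J (Suc n) ^ D)"
      using card_mono[OF finR sub] unfolding cardR by (intro mult_mono) auto
    then have "real (card (\<kappa> n ` ?\<Sigma>) * card (\<kappa> (Suc n) ` ?\<Sigma>)) \<le> real ((W * J n ^ D) * (W * J (Suc n) ^ D))"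
      by (rule of_nat_mono)
    also have "\<dots> = real (W * W) * (real (J n) ^ D * real (J (Suc n)) ^ D)" by simp
    also have "\<dots> \<le> real (W * W) * ((A * ln (real n + 3) + B) ^ D * (A * ln (real n + 3) + B) ^ D)"
      using le by (intro mult_left_mono mult_mono power_mono zero_le_power) (auto intro: order_trans[OF of_nat_0_le_iff])
    also have "\<dots> \<le> real n" using elim by (simp add: power_add)
    finally show ?case by (simp only: of_nat_le_iff)
  qed
  then obtain N where N: "\<And>n. n \<ge> N \<Longrightarrow> card (\<kappa> n ` ?\<Sigma>) * card (\<kappa> (Suc n) ` ?\<Sigma>) \<le> n"
    unfolding eventually_sequentially by blast
  show ?thesis
  proof (rule regular_if_few_classes[where \<kappa> = \<kappa> and N = N])
    show "L \<subseteq> ?\<Sigma>" using L by (simp add: recognizes_bounded_error_def)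
    show "finite (\<kappa> n ` ?\<Sigma>)" for n using finite_subset[OF sub finR] .
  qed (use finite_alphabet N sim in blast)+
qed

end

theorem theorem1:
  fixes p :: "real poly" and M :: "('q, 'a) pfa2" and L :: "'a list set"
  assumes "pfa2 M"
    and "\<exists>C::real. \<forall>\<^sub>F n in sequentially. \<forall>x\<in>lists (alphabet M). length x = n \<longrightarrow>
      expected_coin_tosses M x \<le> ennreal (C * \<bar>poly p (real n)\<bar>)"
    and "recognizes_bounded_error M L"
  shows "regular (alphabet M) L"
  using pfa2.bounded_error_regular[OF assms] .

end
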